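(* Let $(G_i,u_i,v_i)$, $i=1,\dots,\ell$, be twice-marked graphs, where $G_i$ has genus $g_i$ and $(G_i,u_i,v_i)$ has torsion order $k_i$, and suppose each $(G_i,u_i,v_i)$ has $k_i$-general transmission. Let $(G,u,v)=(G,u_1,v_\ell)$ be their iterated vertex gluing. (1) If $k_i> g_1+g_2+\cdots+g_i$ for all $i$, then the once-marked graph $(G,v)$ is Brill–Noether general. (2) If $k_i>\min\{g_1+\cdots+g_i,\ g_i+g_{i+1}+\cdots+g_\ell\}$ for all $i$, then $G$ is a Brill–Noether general graph.
   Context: A graph is a finite, connected, loopless multigraph (parallel edges allowed); its genus is $g=|E(G)|-|V(G)|+1$. A divisor on $G$ is an element of the free abelian group on $V(G)$; its degree is the sum of its coefficients, and it is effective if all coefficients are nonnegative. Firing a vertex $w$ subtracts $\mathrm{val}(w)$ chips from $w$ and adds to each other vertex $w'$ the number of edges joining $w$ and $w'$; two divisors are linearly equivalent ($D\sim D'$) if their difference is an integer combination of firing moves. $|D|$ denotes the set of effective divisors linearly equivalent to $D$. The rank $r(D)$ is $-1$ if $|D|=\emptyset$, and otherwise the largest $r\ge 0$ such that $|D-E|\ne\emptyset$ for every effective divisor $E$ of degree $r$. The canonical divisor is $K_G=\sum_w(\mathrm{val}(w)-2)w$. $\delta(P)$ is $1$ if $P$ holds and $0$ otherwise. A twice-marked graph $(G,u,v)$ is a graph with two chosen vertices; its torsion order is the least $k\ge1$ with $ku\sim kv$. A twist of $D$ is a divisor $D+au+bv$, $a,b\in\mathbb Z$. Set $\Delta(D)=r(D)-r(D-u)-r(D-v)+r(D-u-v)$.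 $D$ is submodular if $\Delta(D')\ge 0$ for every twist $D'$ of $D$. If $D$ is submodular, its transmission permutation $\tau^{u,v}_D$ is the unique bijection $\mathbb Z\to\mathbb Z$ with $\delta(\tau^{u,v}_D(b)=a)=\Delta(D+au-bv)$ for all $a,b\in\mathbb Z$ (it exists iff $D$ is submodular). For a bijection $\tau$, an inversion is a pair $(a,b)$ with $a<b$, $\tau(a)>\tau(b)$; inversions $(a,b),(a',b')$ are $k$-equivalent if $a-a'=b-b'\equiv 0\pmod k$; $\mathrm{inv}_k(\tau)$ is the number of $k$-equivalence classes of inversions. A genus-$g$ twice-marked graph has $k$-general transmission if $ku\sim kv$, every divisor is submodular, and $\mathrm{inv}_k(\tau^{u,v}_D)\le g$ for every divisor $D$. Vertex gluing: for twice-marked graphs $(G_1,u_1,v_1),(G_2,u_2,v_2)$, the vertex gluing is $(G,u_1,v_2)$ where $G$ is the disjoint union with $v_1$ identified with $u_2$; the iterated vertex gluing of $(G_i,u_i,v_i)_{1\le i\le\ell}$ is obtained by successively gluing on $(G_2,u_2,v_2),\dots,(G_\ell,u_\ell,v_\ell)$. A graph $G$ of genus $g$ is Brill–Noether general if for every divisor $D$ and every integer $r$ with $0\le r\le r(D)$, $\rho(g,r,\deg D)=g-(r+1)(g-\deg D+r)\ge0$. For a vertex $v$ and divisor $D$ on a genus-$g$ graph, let $s_i(D,v)=\min\{\ell\in\mathbb Z: r(D+\ell v)\ge i\}$ and $\lambda_i(D,v)=i-s_i(D,v)+g-\deg D$ for $i\ge0$; the Weierstrass partition is $\lambda(D,v)=(\lambda_0,\lambda_1,\dots)$,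 a nonincreasing sequence of nonnegative integers with finitely many nonzero, and $|\lambda(D,v)|=\sum_i\lambda_i(D,v)$. A once-marked graph $(G,v)$ of genus $g$ is Brill–Noether general if $|\lambda(D,v)|\le g$ for every divisor $D$. *)

theory Defs
  imports Main "HOL-Library.Extended_Nat"
begin

section \<open>Graphs (finite, connected, loopless multigraphs)\<close>

text \<open>A graph is a pair (V, m): a vertex set V and an edge-multiplicity function m
  (m x y = number of edges joining x and y).\<close>
type_synonym 'v graph = "'v set \<times> ('v \<Rightarrow> 'v \<Rightarrow> nat)"

definition verts :: "'v graph \<Rightarrow> 'v set" where "verts G = fst G"
definition mult :: "'v graph \<Rightarrow> 'v \<Rightarrow> 'v \<Rightarrow> nat" where "mult G = snd G"

definition is_graph :: "'v graph \<Rightarrow> bool" where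
  "is_graph G \<longleftrightarrow> finite (verts G) \<and> verts G \<noteq> {} \<and>
     (\<forall>x y. mult G x y = mult G y x) \<and> (\<forall>x. mult G x x = 0) \<and>
     (\<forall>x y. 0 < mult G x y \<longrightarrow> x \<in> verts G \<and> y \<in> verts G) \<and>
     (\<forall>x\<in>verts G. \<forall>y\<in>verts G. (x, y) \<in> {(a, b). 0 < mult G a b}\<^sup>*)"

definition val :: "'v graph \<Rightarrow> 'v \<Rightarrow> nat" where
  "val G w = (\<Sum>y\<in>verts G. mult G w y)"

definition num_edges :: "'v graph \<Rightarrow> nat" where
  "num_edges G = (\<Sum>x\<in>verts G. \<Sum>y\<in>verts G. mult G x y) div 2"

definition genus :: "'v graph \<Rightarrow> int" where
  "genus G = int (num_edges G) - int (card (verts G)) + 1"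

section \<open>Divisors\<close>

definition is_divisor :: "'v graph \<Rightarrow> ('v \<Rightarrow> int) \<Rightarrow> bool" where
  "is_divisor G D \<longleftrightarrow> (\<forall>x. x \<notin> verts G \<longrightarrow> D x = 0)"

definition deg :: "'v graph \<Rightarrow> ('v \<Rightarrow> int) \<Rightarrow> int" where
  "deg G D = (\<Sum>x\<in>verts G. D x)"

definition effective :: "'v graph \<Rightarrow> ('v \<Rightarrow> int) \<Rightarrow> bool" where
  "effective G D \<longleftrightarrow> (\<forall>x\<in>verts G. 0 \<le> D x)"

text \<open>The divisor obtained by firing vertex w (as a change vector).\<close>
definition fire :: "'v graph \<Rightarrow> 'v \<Rightarrow> 'v \<Rightarrow> int" where
  "fire G w x = (if x = w then - int (val G w) else int (mult G w x))"

definition lin_equiv :: "'v graph \<Rightarrow> ('v \<Rightarrow> int) \<Rightarrow> ('v \<Rightarrow> int) \<Rightarrow> bool" where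
  "lin_equiv G D D' \<longleftrightarrow>
     (\<exists>c :: 'v \<Rightarrow> int. \<forall>x\<in>verts G. D' x = D x + (\<Sum>w\<in>verts G. c w * fire G w x))"

text \<open>|D| is nonempty.\<close>
definition linsys_nonempty :: "'v graph \<Rightarrow> ('v \<Rightarrow> int) \<Rightarrow> bool" where
  "linsys_nonempty G D \<longleftrightarrow> (\<exists>D'. is_divisor G D' \<and> effective G D' \<and> lin_equiv G D D')"

definition rank :: "'v graph \<Rightarrow> ('v \<Rightarrow> int) \<Rightarrow> int" where
  "rank G D = (if \<not> linsys_nonempty G D then -1 else
     int (GREATEST r::nat. \<forall>E. is_divisor G E \<and> effective G E \<and> deg G E = int r \<longrightarrow>
                               linsys_nonempty G (\<lambda>x. D x - E x)))"

definition ind :: "'v \<Rightarrow> 'v \<Rightarrow> int" where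
  "ind a x = (if x = a then 1 else 0)"

section \<open>Twice-marked graphs and transmission permutations\<close>

definition twice_marked :: "'v graph \<Rightarrow> 'v \<Rightarrow> 'v \<Rightarrow> bool" where
  "twice_marked G u v \<longleftrightarrow> is_graph G \<and> u \<in> verts G \<and> v \<in> verts G"

definition torsion_order :: "'v graph \<Rightarrow> 'v \<Rightarrow> 'v \<Rightarrow> nat \<Rightarrow> bool" where
  "torsion_order G u v k \<longleftrightarrow> 1 \<le> k \<and>
     lin_equiv G (\<lambda>x. int k * ind u x) (\<lambda>x. int k * ind v x) \<and>
     (\<forall>j. 1 \<le> j \<and> j < k \<longrightarrow> \<not> lin_equiv G (\<lambda>x. int j * ind u x) (\<lambda>x. int j * ind v x))"

definition twist :: "'v \<Rightarrow> 'v \<Rightarrow> ('v \<Rightarrow> int) \<Rightarrow> int \<Rightarrow> int \<Rightarrow> 'v \<Rightarrow> int" where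
  "twist u v D a b = (\<lambda>x. D x + a * ind u x + b * ind v x)"

definition Delta :: "'v graph \<Rightarrow> 'v \<Rightarrow> 'v \<Rightarrow> ('v \<Rightarrow> int) \<Rightarrow> int" where
  "Delta G u v D = rank G D - rank G (twist u v D (-1) 0) - rank G (twist u v D 0 (-1))
                   + rank G (twist u v D (-1) (-1))"

definition submodular :: "'v graph \<Rightarrow> 'v \<Rightarrow> 'v \<Rightarrow> ('v \<Rightarrow> int) \<Rightarrow> bool" where
  "submodular G u v D \<longleftrightarrow> (\<forall>a b. 0 \<le> Delta G u v (twist u v D a b))"

definition transmission_perm :: "'v graph \<Rightarrow> 'v \<Rightarrow> 'v \<Rightarrow> ('v \<Rightarrow> int) \<Rightarrow> int \<Rightarrow> int" where
  "transmission_perm G u v D = (THE \<tau>. bij \<tau> \<and>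
      (\<forall>a b. (if \<tau> b = a then 1 else 0) = Delta G u v (twist u v D a (-b))))"

definition inversions :: "(int \<Rightarrow> int) \<Rightarrow> (int \<times> int) set" where
  "inversions \<tau> = {(a, b). a < b \<and> \<tau> b < \<tau> a}"

definition kequiv :: "nat \<Rightarrow> (int \<Rightarrow> int) \<Rightarrow> ((int \<times> int) \<times> (int \<times> int)) set" where
  "kequiv k \<tau> = {(p, q). p \<in> inversions \<tau> \<and> q \<in> inversions \<tau> \<and>
      fst p - fst q = snd p - snd q \<and> int k dvd (fst p - fst q)}"

text \<open>Number of k-equivalence classes of inversions (infinity if infinitely many).\<close>
definition inv_k :: "nat \<Rightarrow> (int \<Rightarrow> int) \<Rightarrow> enat" where
  "inv_k k \<tau> = (let C = inversions \<tau> // kequiv k \<tau> in if finite C then enat (card C) else \<infinity>)"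

definition general_transmission :: "'v graph \<Rightarrow> 'v \<Rightarrow> 'v \<Rightarrow> nat \<Rightarrow> bool" where
  "general_transmission G u v k \<longleftrightarrow>
     lin_equiv G (\<lambda>x. int k * ind u x) (\<lambda>x. int k * ind v x) \<and>
     (\<forall>D. is_divisor G D \<longrightarrow> submodular G u v D) \<and>
     (\<forall>D. is_divisor G D \<longrightarrow> inv_k k (transmission_perm G u v D) \<le> enat (nat (genus G)))"

section \<open>Brill--Noether generality\<close>

definition bn_general :: "'v graph \<Rightarrow> bool" where
  "bn_general G \<longleftrightarrow> (\<forall>D. is_divisor G D \<longrightarrow> (\<forall>r::int. 0 \<le> r \<and> r \<le> rank G D \<longrightarrow>
      0 \<le> genus G - (r + 1) * (genus G - deg G D + r)))"

definition s_seq :: "'v graph \<Rightarrow> ('v \<Rightarrow> int) \<Rightarrow> 'v \<Rightarrow> nat \<Rightarrow> int" where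
  "s_seq G D v i = (LEAST l::int. int i \<le> rank G (\<lambda>x. D x + l * ind v x))"

definition wlambda :: "'v graph \<Rightarrow> ('v \<Rightarrow> int) \<Rightarrow> 'v \<Rightarrow> nat \<Rightarrow> int" where
  "wlambda G D v i = int i - s_seq G D v i + genus G - deg G D"

definition once_marked_bn_general :: "'v graph \<Rightarrow> 'v \<Rightarrow> bool" where
  "once_marked_bn_general G v \<longleftrightarrow> (\<forall>D. is_divisor G D \<longrightarrow>
      finite {i. wlambda G D v i \<noteq> 0} \<and>
      (\<Sum>i\<in>{i. wlambda G D v i \<noteq> 0}. wlambda G D v i) \<le> genus G)"

section \<open>Iterated vertex gluing\<close>

text \<open>A list Gs of twice-marked graphs (G_i, u_i, v_i), indexed 0..length Gs - 1.
  The glued graph has as vertices the classes of pairs (i, x), x a vertex of G_i,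
  under the equivalence generated by (i, v_i) ~ (i+1, u_(i+1)).\<close>

definition tg :: "('v graph \<times> 'v \<times> 'v) \<Rightarrow> 'v graph" where "tg T = fst T"
definition tu :: "('v graph \<times> 'v \<times> 'v) \<Rightarrow> 'v" where "tu T = fst (snd T)"
definition tv :: "('v graph \<times> 'v \<times> 'v) \<Rightarrow> 'v" where "tv T = snd (snd T)"

definition gl_base :: "('v graph \<times> 'v \<times> 'v) list \<Rightarrow> (nat \<times> 'v) set" where
  "gl_base Gs = {(i, x). i < length Gs \<and> x \<in> verts (tg (Gs ! i))}"

definition gl_step :: "('v graph \<times> 'v \<times> 'v) list \<Rightarrow> nat \<times> 'v \<Rightarrow> nat \<times> 'v \<Rightarrow> bool" where
  "gl_step Gs p q \<longleftrightarrow> (\<exists>i. Suc i < length Gs \<and> p = (i, tv (Gs ! i)) \<and> q = (Suc i, tu (Gs ! Suc i)))"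

definition gl_class :: "('v graph \<times> 'v \<times> 'v) list \<Rightarrow> nat \<times> 'v \<Rightarrow> (nat \<times> 'v) set" where
  "gl_class Gs p = {q \<in> gl_base Gs. equivclp (gl_step Gs) p q}"

definition gl_graph :: "('v graph \<times> 'v \<times> 'v) list \<Rightarrow> (nat \<times> 'v) set graph" where
  "gl_graph Gs = (gl_class Gs ` gl_base Gs,
     \<lambda>A B. if A \<in> gl_class Gs ` gl_base Gs \<and> B \<in> gl_class Gs ` gl_base Gs \<and> A \<noteq> B then
        (\<Sum>i<length Gs. \<Sum>x\<in>verts (tg (Gs ! i)). \<Sum>y\<in>verts (tg (Gs ! i)).
            if (i, x) \<in> A \<and> (i, y) \<in> B then mult (tg (Gs ! i)) x y else 0)
      else 0)"

text \<open>The iterated vertex gluing (G, u_1, v_l).\<close>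
definition glue :: "('v graph \<times> 'v \<times> 'v) list \<Rightarrow> (nat \<times> 'v) set graph \<times> (nat \<times> 'v) set \<times> (nat \<times> 'v) set" where
  "glue Gs = (gl_graph Gs, gl_class Gs (0, tu (Gs ! 0)),
              gl_class Gs (length Gs - 1, tv (Gs ! (length Gs - 1))))"

end

theory Submission
  imports Defs "HOL-Library.FuncSet"
begin

text \<open>For a divisor \<open>D\<close> on a graph of genus \<open>g\<close> marked at \<open>v\<close>, put \<open>F b = r(D - b v) + 1\<close> and
  \<open>c = deg D - g + 1\<close>. By Riemann's inequality \<open>F b \<ge> max 0 (c - b)\<close>, and the total excess (the weight
  of \<open>F\<close>) is the size of the Weierstrass partition of \<open>D\<close> at \<open>v\<close>.

  If \<open>A\<close> and \<open>B\<close> share only the vertex \<open>w\<close>, then \<open>r(DA + DB) + 1 \<le> (r(DA + l w) + 1) + (r(DB - (l + 1) w) + 1)\<close>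
  for every \<open>l\<close>. Hence gluing on a graph whose transmission permutation is \<open>\<tau>\<close> turns \<open>F\<close> into a function bounded
  by the min-plus product of \<open>F\<close> with the counting function of \<open>\<tau>\<close>. Factoring the \<open>k\<close>-periodic
  permutation \<open>\<tau>\<close> into \<open>inv\<^sub>k \<tau>\<close> adjacent swaps, each performed simultaneously modulo \<open>k\<close>, every swap raises \<open>F\<close>
  at positions congruent modulo \<open>k\<close>. While the weight is at most \<open>k - 2\<close> at most one
  position is raised, and by at most one, so the weight grows by at most \<open>inv\<^sub>k \<tau> \<le> g\<close>. This gives (1).

  For (2), cut the chain where the minimum switches from the prefix sum to the suffix sum. Both halves satisfy (1) at the
  cut vertex, and the inequality for \<open>r(DA + DB)\<close>, summed over all \<open>l\<close>, bounds \<open>(r + 1) (g - d + r)\<close> by the sum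
  of the two weights.\<close>

section \<open>Profiles and their weight\<close>

definition gap :: "int \<Rightarrow> (int \<Rightarrow> int) \<Rightarrow> int \<Rightarrow> int" where
  "gap c F b = F b - max 0 (c - b)"

definition weight :: "int \<Rightarrow> (int \<Rightarrow> int) \<Rightarrow> int" where
  "weight c F = (\<Sum>b | gap c F b \<noteq> 0. gap c F b)"

text \<open>Modelled on \<open>r(D - b v) + 1\<close> as a function of \<open>b\<close>: removing
  one chip lowers the rank by 0 or 1, in large degree Riemann's bound is attained, and in negative
  degree the value is 0.\<close>

definition profile :: "int \<Rightarrow> (int \<Rightarrow> int) \<Rightarrow> bool" where
  "profile c F \<longleftrightarrow> (\<forall>b. F (b + 1) \<le> F b \<and> F b \<le> F (b + 1) + 1) \<and>
     (\<exists>lo. \<forall>b\<le>lo. F b = c - b) \<and> (\<exists>hi. \<forall>b\<ge>hi. F b = 0)"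

lemma slope_bounds:
  fixes F :: "int \<Rightarrow> int"
  assumes "\<And>b. F (b + 1) \<le> F b \<and> F b \<le> F (b + 1) + 1" and "b \<le> b'"
  shows "F b' \<le> F b" and "F b \<le> F b' + (b' - b)"
proof -
  have "F b' \<le> F b \<and> F b \<le> F b' + (b' - b)"
    using assms(2)
  proof (induction b' rule: int_ge_induct)
    case (step i)
    then show ?case using assms(1)[of i] by linarith
  qed simp
  then show "F b' \<le> F b" "F b \<le> F b' + (b' - b)" by auto
qed

lemma profile_mono: "profile c F \<Longrightarrow> b \<le> b' \<Longrightarrow> F b' \<le> F b"
  using slope_bounds(1)[of F b b'] by (simp add: profile_def)

lemma profile_lipschitz: "profile c F \<Longrightarrow> b \<le> b' \<Longrightarrow> F b \<le> F b' + (b' - b)"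
  using slope_bounds(2)[of F b b'] by (simp add: profile_def)

lemma profile_nonneg:
  assumes "profile c F" shows "0 \<le> F b"
proof -
  obtain hi where "\<forall>b\<ge>hi. F b = 0" using assms by (auto simp: profile_def)
  then have "F (max b hi) = 0" by simp
  then show ?thesis using profile_mono[OF assms, of b "max b hi"] by simp
qed

lemma profile_ge:
  assumes "profile c F" shows "c - b \<le> F b"
proof -
  obtain lo where lo: "\<forall>b\<le>lo. F b = c - b" using assms by (auto simp: profile_def)
  then have "F (min b lo) = c - min b lo" by simp
  then show ?thesis using profile_lipschitz[OF assms, of "min b lo" b] by simp
qed

lemma gap_nonneg: "profile c F \<Longrightarrow> 0 \<le> gap c F b"
  using profile_nonneg[of c F b] profile_ge[of c F b] by (simp add: gap_def)

lemma finite_gap: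
  assumes "profile c F" shows "finite {b. gap c F b \<noteq> 0}"
proof -
  obtain lo hi where lo: "\<forall>b\<le>lo. F b = c - b" and hi: "\<forall>b\<ge>hi. F b = 0"
    using assms by (auto simp: profile_def)
  have "gap c F b = 0" if "b \<le> lo \<or> hi \<le> b" for b
    using that lo hi profile_nonneg[OF assms, of b] profile_ge[OF assms, of b]
    by (auto simp: gap_def)
  then have "{b. gap c F b \<noteq> 0} \<subseteq> {lo..hi}" by (auto simp del: not_le) (meson linear)+
  then show ?thesis using finite_subset by blast
qed

lemma weight_eq_sum:
  assumes "finite S" "{b. gap c F b \<noteq> 0} \<subseteq> S"
  shows "weight c F = sum (gap c F) S"
  unfolding weight_def by (rule sum.mono_neutral_left) (use assms in auto)

lemma sum_le_weight:
  assumes "profile c F" "finite S"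
  shows "sum (gap c F) S \<le> weight c F"
proof -
  have "weight c F = sum (gap c F) (S \<union> {b. gap c F b \<noteq> 0})"
    by (rule weight_eq_sum) (use assms finite_gap in auto)
  moreover have "sum (gap c F) S \<le> sum (gap c F) (S \<union> {b. gap c F b \<noteq> 0})"
    by (rule sum_mono2) (use assms finite_gap gap_nonneg in auto)
  ultimately show ?thesis by simp
qed

lemma profile_point: "profile c (\<lambda>b. max 0 (c - b))"
proof -
  have "\<forall>b\<le>c. max 0 (c - b) = c - b" "\<forall>b\<ge>c. max 0 (c - b) = 0" by auto
  then show ?thesis unfolding profile_def by (intro conjI) (force, blast, blast)
qed

lemma weight_point: "weight c (\<lambda>b. max 0 (c - b)) = 0"
  by (simp add: weight_def gap_def)

lemma profile_shift:
  assumes "profile c F" shows "profile (c - t) (\<lambda>b. F (b + t))"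
proof -
  obtain lo hi where lo: "\<forall>b\<le>lo. F b = c - b" and hi: "\<forall>b\<ge>hi. F b = 0"
    using assms by (auto simp: profile_def)
  have "F (b + 1 + t) \<le> F (b + t) \<and> F (b + t) \<le> F (b + 1 + t) + 1" for b
    using assms unfolding profile_def by (metis (no_types, opaque_lifting) add.commute add.left_commute)
  moreover have "\<forall>b\<le>lo - t. F (b + t) = c - t - b" using lo by auto
  moreover have "\<forall>b\<ge>hi - t. F (b + t) = 0" using hi by auto
  ultimately show ?thesis unfolding profile_def by blast
qed

lemma weight_shift: "weight (c - t) (\<lambda>b. F (b + t)) = weight c F"
proof -
  have g: "gap (c - t) (\<lambda>b. F (b + t)) b = gap c F (b + t)" for b
    by (simp add: gap_def algebra_simps)
  show ?thesis unfolding weight_def g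
    by (rule sum.reindex_bij_witness[where i = "\<lambda>b. b - t" and j = "\<lambda>b. b + t"]) auto
qed

text \<open>The new value is the largest one at \<open>b\<close> compatible with the slopes of a
  profile and the two neighbouring values of \<open>F\<close>. It is the effect on a profile of one
  adjacent swap performed modulo \<open>k\<close>.\<close>

definition bump :: "nat \<Rightarrow> int \<Rightarrow> (int \<Rightarrow> int) \<Rightarrow> int \<Rightarrow> int" where
  "bump k n F b = (if (b - n) mod int k = 0 then min (F (b - 1)) (F (b + 1) + 1) else F b)"

lemma profile_stepD: "profile c F \<Longrightarrow> F (b + 1) \<le> F b \<and> F b \<le> F (b + 1) + 1"
  by (simp add: profile_def)

lemma bump_bounds:
  assumes "profile c F" shows "F b \<le> bump k n F b" "bump k n F b \<le> F b + 1"
  using profile_stepD[OF assms, of "b - 1"] profile_stepD[OF assms, of b] by (auto simp: bump_def)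

lemma consecutive_not_both_multiples:
  assumes "2 \<le> k" "(b - n) mod int k = 0" shows "(b + 1 - n) mod int k \<noteq> 0"
proof
  assume "(b + 1 - n) mod int k = 0"
  then have "int k dvd (b + 1 - n) - (b - n)" using assms(2) by (metis dvd_diff mod_0_imp_dvd)
  then show False using assms(1) by simp
qed

lemma profile_bump:
  assumes F: "profile c F" and k: "2 \<le> k"
  shows "profile c (bump k n F)"
proof -
  obtain lo hi where lo: "\<forall>b\<le>lo. F b = c - b" and hi: "\<forall>b\<ge>hi. F b = 0"
    using F by (auto simp: profile_def)
  have "bump k n F (b + 1) \<le> bump k n F b \<and> bump k n F b \<le> bump k n F (b + 1) + 1" for b
    using consecutive_not_both_multiples[OF k, of b n]
      profile_stepD[OF F, of "b - 1"] profile_stepD[OF F, of b] profile_stepD[OF F, of "b + 1"]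
    by (auto simp: bump_def add.commute)
  \<comment> \<open>The thresholds move by one because a raised value is read off at
    \<open>b - 1\<close> and \<open>b + 1\<close>.\<close>
  moreover have "\<forall>b\<le>lo - 1. bump k n F b = c - b" using lo by (auto simp: bump_def)
  moreover have "\<forall>b\<ge>hi + 1. bump k n F b = 0" using hi by (auto simp: bump_def)
  ultimately show ?thesis unfolding profile_def by blast
qed

text \<open>Two positions \<open>b < b'\<close> raised by the same bump are at least \<open>k\<close> apart. The graph of
  \<open>F\<close> is flat just after \<open>b\<close> and still positive just before \<open>b'\<close>, so every gap in between
  is positive and the weight is at least \<open>k - 1\<close>.\<close>

lemma bump_raises_at_most_one:
  assumes F: "profile c F" and w: "weight c F + 2 \<le> int k"
    and b: "bump k n F b \<noteq> F b" and b': "bump k n F b' \<noteq> F b'" and less: "b < b'"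
  shows False
proof -
  have m: "(b - n) mod int k = 0" "(b' - n) mod int k = 0"
    using b b' by (auto simp: bump_def split: if_splits)
  then have "int k dvd (b' - n) - (b - n)" by (metis dvd_diff mod_0_imp_dvd)
  then have k: "int k \<le> b' - b" using less zdvd_imp_le by fastforce
  have flat: "F (b + 1) = F b"
    using b m(1) profile_stepD[OF F, of "b - 1"] profile_stepD[OF F, of b] by (auto simp: bump_def)
  have drop: "F (b' - 1) = F b' + 1"
    using b' m(2) profile_stepD[OF F, of "b' - 1"] profile_stepD[OF F, of b'] by (auto simp: bump_def)
  have "1 \<le> gap c F j" if "j \<in> {b+1..b'-1}" for j
  proof -
    have "1 \<le> F (b' - 1)" using drop profile_nonneg[OF F, of b'] by simp
    then have "1 \<le> F j" using profile_mono[OF F, of j "b' - 1"] that by simp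
    moreover have "c - j + 1 \<le> F j"
      using profile_lipschitz[OF F, of "b + 1" j] flat profile_ge[OF F, of b] that by simp
    ultimately show ?thesis by (simp add: gap_def)
  qed
  then have "(\<Sum>j\<in>{b+1..b'-1}. 1) \<le> (\<Sum>j\<in>{b+1..b'-1}. gap c F j)" by (rule sum_mono)
  also have "\<dots> \<le> weight c F" by (rule sum_le_weight[OF F]) simp
  finally show False using w k less by simp
qed

lemma weight_bump:
  assumes F: "profile c F" and w: "weight c F + 2 \<le> int k" and k: "2 \<le> k"
  shows "weight c (bump k n F) \<le> weight c F + 1"
proof -
  let ?F = "bump k n F"
  let ?S = "{b. gap c F b \<noteq> 0} \<union> {b. gap c ?F b \<noteq> 0}"
  let ?R = "{b. ?F b \<noteq> F b}"
  have fin: "finite ?S" using finite_gap[OF F] finite_gap[OF profile_bump[OF F k]] by blast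
  have "finite ?R \<and> card ?R \<le> 1"
  proof (cases "?R = {}")
    case False
    then obtain b where "b \<in> ?R" by blast
    then have "?R \<subseteq> {b}"
      using bump_raises_at_most_one[OF F w, of n] by (metis (mono_tags) linorder_neqE mem_Collect_eq singletonI subsetI)
    then show ?thesis using card_mono[of "{b}" ?R] finite_subset[of ?R "{b}"] by auto
  qed (metis card.empty finite.emptyI zero_le)
  then have R: "finite ?R" "card ?R \<le> 1" by auto
  have "weight c ?F = sum (gap c ?F) ?S" by (rule weight_eq_sum[OF fin]) auto
  also have "\<dots> \<le> (\<Sum>b\<in>?S. gap c F b + (if b \<in> ?R then 1 else 0))"
    by (rule sum_mono) (use bump_bounds(2)[OF F] in \<open>auto simp: gap_def\<close>)
  also have "\<dots> = sum (gap c F) ?S + int (card (?S \<inter> ?R))"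
    using fin by (simp add: sum.distrib sum.If_cases)
  also have "sum (gap c F) ?S = weight c F" by (rule weight_eq_sum[OF fin, symmetric]) auto
  also have "int (card (?S \<inter> ?R)) \<le> 1" using R card_mono[OF R(1), of "?S \<inter> ?R"] by auto
  finally show ?thesis by simp
qed

section \<open>Affine permutations acting on profiles\<close>

definition affine :: "nat \<Rightarrow> (int \<Rightarrow> int) \<Rightarrow> bool" where
  "affine k \<tau> \<longleftrightarrow> 1 \<le> k \<and> bij \<tau> \<and> (\<forall>n. \<tau> (n + int k) = \<tau> n + int k)"

text \<open>For a transmission permutation, \<open>cnt \<tau> (a + 1) b\<close> is
  \<open>r(D + a u - b v) + 1\<close>: it adds up \<open>\<Delta>\<close> over a quadrant.\<close>

definition cnt :: "(int \<Rightarrow> int) \<Rightarrow> int \<Rightarrow> int \<Rightarrow> int" where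
  "cnt \<tau> a b = int (card {n. b \<le> n \<and> \<tau> n < a})"

text \<open>For an affine \<open>\<tau>\<close> every \<open>k\<close>-equivalence class of
  inversions has exactly one member whose first entry lies in \<open>{0..<k}\<close>, so the
  cardinality of this set stands for \<open>inv\<^sub>k\<close>.\<close>

definition invs :: "nat \<Rightarrow> (int \<Rightarrow> int) \<Rightarrow> (int \<times> int) set" where
  "invs k \<tau> = {(a, b). 0 \<le> a \<and> a < int k \<and> a < b \<and> \<tau> b < \<tau> a}"

lemma affine_mult:
  assumes "affine k \<tau>" shows "\<tau> (n + int k * m) = \<tau> n + int k * m"
proof (induction m rule: int_induct[where k = 0])
  case (step1 i)
  have "\<tau> (n + int k * (i + 1)) = \<tau> ((n + int k * i) + int k)" by (simp add: algebra_simps)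
  also have "\<dots> = \<tau> (n + int k * i) + int k" using assms unfolding affine_def by blast
  finally show ?case using step1 by (simp add: algebra_simps)
next
  case (step2 i)
  have "\<tau> (n + int k * (i - 1) + int k) = \<tau> (n + int k * (i - 1)) + int k"
    using assms unfolding affine_def by blast
  then show ?case using step2 by (simp add: algebra_simps)
qed simp

lemma affine_inj: "affine k \<tau> \<Longrightarrow> \<tau> x = \<tau> y \<longleftrightarrow> x = y"
  by (auto simp: affine_def bij_def inj_eq)

lemma finite_cnt:
  assumes "affine k \<tau>" shows "finite {n. b \<le> n \<and> \<tau> n < a}"
proof -
  \<comment> \<open>By periodicity \<open>\<tau>\<close> grows by \<open>k m\<close> from the window
    \<open>{b..<b + k}\<close> to its \<open>m\<close>-th translate, so the minimum over that window
    bounds all \<open>n\<close> with \<open>\<tau> n < a\<close>.\<close>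
  define M where "M = Min (\<tau> ` {b..<b + int k})"
  have k: "0 < int k" using assms by (simp add: affine_def)
  have "n \<le> b + int k + (a - M)" if "b \<le> n" "\<tau> n < a" for n
  proof -
    let ?r = "b + (n - b) mod int k" and ?m = "(n - b) div int k"
    have n: "n = ?r + int k * ?m" by (simp add: algebra_simps)
    have r: "?r \<in> {b..<b + int k}" using k by simp
    then have "M \<le> \<tau> ?r" unfolding M_def by (intro Min_le) auto
    moreover have "\<tau> n = \<tau> ?r + int k * ?m" using affine_mult[OF assms, of ?r ?m] n by simp
    ultimately have "int k * ?m \<le> a - M" using that by linarith
    moreover have "?r < b + int k" using r by simp
    ultimately show ?thesis using n by linarith
  qed
  then have "{n. b \<le> n \<and> \<tau> n < a} \<subseteq> {b..b + int k + (a - M)}" by auto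
  then show ?thesis using finite_subset by blast
qed

lemma cnt_step:
  assumes "affine k \<tau>"
  shows "cnt \<tau> a b = cnt \<tau> a (b + 1) + (if \<tau> b < a then 1 else 0)"
proof (cases "\<tau> b < a")
  case True
  then have "{n. b \<le> n \<and> \<tau> n < a} = insert b {n. b + 1 \<le> n \<and> \<tau> n < a}" by auto
  then show ?thesis using True finite_cnt[OF assms] by (simp add: cnt_def)
next
  case False
  then have "{n. b \<le> n \<and> \<tau> n < a} = {n. b + 1 \<le> n \<and> \<tau> n < a}"
    by (auto simp: order_le_less)
  then show ?thesis using False by (simp add: cnt_def)
qed

lemma finite_invs:
  assumes "affine k \<tau>" shows "finite (invs k \<tau>)"
proof -
  have "invs k \<tau> \<subseteq> Sigma {0..<int k} (\<lambda>a. {n. a \<le> n \<and> \<tau> n < \<tau> a})" by (auto simp: invs_def)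
  then show ?thesis by (rule finite_subset) (intro finite_SigmaI finite_cnt[OF assms], simp)
qed

section \<open>Adjacent swaps performed simultaneously modulo \<open>k\<close>\<close>

definition swp :: "nat \<Rightarrow> int \<Rightarrow> int \<Rightarrow> int" where
  "swp k n j = (if (j + 1 - n) mod int k = 0 then j + 1 else if (j - n) mod int k = 0 then j - 1 else j)"

lemma swp_swp: assumes "2 \<le> k" shows "swp k n (swp k n j) = j"
  using consecutive_not_both_multiples[OF assms, of j n]
    consecutive_not_both_multiples[OF assms, of "j + 1" n]
    consecutive_not_both_multiples[OF assms, of "j - 1" n]
  by (auto simp: swp_def add.commute)

lemma swp_shift: "swp k n (j + int k * m) = swp k n j + int k * m"
proof -
  have "(j + int k * m + 1 - n) mod int k = (j + 1 - n) mod int k"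
    using mod_mult_self2[of "j + 1 - n" "int k" m] by (simp add: algebra_simps)
  moreover have "(j + int k * m - n) mod int k = (j - n) mod int k"
    using mod_mult_self2[of "j - n" "int k" m] by (simp add: algebra_simps)
  ultimately show ?thesis by (simp add: swp_def)
qed

lemma affine_swp:
  assumes "affine k \<tau>" "2 \<le> k" shows "affine k (\<tau> \<circ> swp k n)"
proof -
  have "bij (swp k n)" using swp_swp[OF assms(2)] by (intro o_bij[of "swp k n"]) (auto simp: fun_eq_iff)
  moreover have "\<tau> (swp k n (j + int k)) = \<tau> (swp k n j) + int k" for j
    using swp_shift[of k n j 1] assms(1) by (simp add: affine_def)
  ultimately show ?thesis using assms by (auto simp: affine_def bij_comp)
qed

text \<open>Entries cross the threshold \<open>b\<close> only if \<open>b - 1\<close> and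
  \<open>b\<close> form an exchanged pair, that is, if \<open>b\<close> is congruent to
  \<open>n\<close> modulo \<open>k\<close>. Hence counts from all other thresholds survive the
  swap.\<close>

lemma swp_ge_iff:
  assumes "(b - n) mod int k \<noteq> 0" shows "b \<le> swp k n j \<longleftrightarrow> b \<le> j"
proof -
  have "b \<noteq> j + 1" if "(j + 1 - n) mod int k = 0" using that assms by auto
  moreover have "b \<noteq> j" if "(j - n) mod int k = 0" using that assms by auto
  ultimately show ?thesis unfolding swp_def by force
qed

lemma cnt_swp:
  assumes "2 \<le> k" "(b - n) mod int k \<noteq> 0"
  shows "cnt (\<tau> \<circ> swp k n) a b = cnt \<tau> a b"
proof -
  have "bij_betw (swp k n) {j. b \<le> j \<and> (\<tau> \<circ> swp k n) j < a} {j. b \<le> j \<and> \<tau> j < a}"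
    by (rule bij_betw_byWitness[where f' = "swp k n"])
      (auto simp: swp_swp[OF assms(1)] swp_ge_iff[OF assms(2)])
  then show ?thesis unfolding cnt_def by (simp add: bij_betw_same_card)
qed

text \<open>Every entry moves by at most one, so the order of two entries can change only if they
  are adjacent and exchanged with each other.\<close>

lemma swp_less:
  assumes k: "2 \<le> k" and "a < b" and "\<not> ((b - n) mod int k = 0 \<and> b = a + 1)"
  shows "swp k n a < swp k n b"
proof -
  have ne: "swp k n a \<noteq> swp k n b" using swp_swp[OF k, of n] assms(2) by (metis less_irrefl)
  have "a - 1 \<le> swp k n a" "swp k n a \<le> a + 1" "b - 1 \<le> swp k n b" "swp k n b \<le> b + 1"
    by (auto simp: swp_def)
  moreover have "swp k n a = a + 1 \<Longrightarrow> (a + 1 - n) mod int k = 0"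
    by (auto simp: swp_def split: if_splits)
  moreover have "swp k n b \<noteq> b - 1" if "(b - n) mod int k \<noteq> 0"
    using that by (auto simp: swp_def split: if_splits)
  ultimately show ?thesis using ne assms by (cases "b = a + 1") (force, linarith)
qed

text \<open>Removing a descent at \<open>n - 1\<close>: conjugating an inversion by the swap and translating it back to
  a representative with first entry in \<open>{0..<k}\<close> embeds the inversions of \<open>\<tau> \<circ> swp k n\<close> into those
  of \<open>\<tau>\<close>, missing the class of \<open>(n - 1, n)\<close>.\<close>

lemma card_invs_swp:
  assumes \<tau>: "affine k \<tau>" and k: "2 \<le> k" and descent: "\<tau> n < \<tau> (n - 1)"
  shows "card (invs k (\<tau> \<circ> swp k n)) < card (invs k \<tau>)"
proof -
  define N where "N = (\<lambda>(a, b). (a - int k * (a div int k), b - int k * (a div int k)))"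
  define f where "f = (\<lambda>(a, b). N (swp k n a, swp k n b))"
  have k0: "0 < int k" using k by simp
  have N_inv: "N (a, b) \<in> invs k \<tau>" if "a < b" "\<tau> b < \<tau> a" for a b
  proof -
    have "a - int k * (a div int k) = a mod int k" by (simp add: minus_mult_div_eq_mod)
    moreover have "\<tau> (x - int k * m) = \<tau> x - int k * m" for x m
      using affine_mult[OF \<tau>, of x "- m"] by simp
    moreover have "\<tau> (a mod int k) = \<tau> a - int k * (a div int k)"
      using affine_mult[OF \<tau>, of a "- (a div int k)"] by (simp add: minus_mult_div_eq_mod)
    ultimately show ?thesis using that k0 by (auto simp: N_def invs_def)
  qed
  have eq_shift: "\<exists>m. a = a' + int k * m \<and> b = b' + int k * m" if "N (a, b) = N (a', b')" for a b a' b'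
    using that by (intro exI[of _ "a div int k - a' div int k"]) (auto simp: N_def algebra_simps)
  have unswap: "\<exists>m. a = swp k n a' + int k * m \<and> b = swp k n b' + int k * m"
    if fN: "f (a, b) = N (a', b')" for a b a' b'
  proof -
    obtain m where "swp k n a = a' + int k * m" "swp k n b = b' + int k * m"
      using eq_shift[of "swp k n a" "swp k n b" a' b'] fN by (auto simp: f_def)
    then show ?thesis by (metis swp_shift swp_swp[OF k])
  qed
  have "inj_on f (invs k (\<tau> \<circ> swp k n))"
  proof (rule inj_onI, clarify)
    fix a b a' b'
    assume I: "(a, b) \<in> invs k (\<tau> \<circ> swp k n)" "(a', b') \<in> invs k (\<tau> \<circ> swp k n)"
      and "f (a, b) = f (a', b')"
    then obtain m where m: "a = a' + int k * m" "b = b' + int k * m"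
      using unswap[of a b "swp k n a'" "swp k n b'"] swp_swp[OF k] by (auto simp: f_def)
    have "0 \<le> a" "a < int k" "0 \<le> a'" "a' < int k" using I by (auto simp: invs_def)
    then have "a = a'" using m(1) by (metis mod_mult_self2 mod_pos_pos_trivial)
    then show "a = a' \<and> b = b'" using m by auto
  qed
  moreover have "f ` invs k (\<tau> \<circ> swp k n) \<subseteq> invs k \<tau> - {N (n - 1, n)}"
  proof (rule image_subsetI, rule DiffI)
    fix p assume "p \<in> invs k (\<tau> \<circ> swp k n)"
    moreover obtain a b where p: "p = (a, b)" by force
    ultimately have ab: "a < b" "\<tau> (swp k n b) < \<tau> (swp k n a)" by (auto simp: invs_def)
    have "\<not> ((b - n) mod int k = 0 \<and> b = a + 1)"
    proof
      assume as: "(b - n) mod int k = 0 \<and> b = a + 1"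
      then obtain m where m: "b = n + int k * m" by (metis add_diff_cancel_left' diff_add_cancel dvd_def mod_0_imp_dvd add.commute)
      have "swp k n b = b - 1" "swp k n a = b"
        using as consecutive_not_both_multiples[OF k, of b n] by (auto simp: swp_def)
      then have "\<tau> (b - 1) < \<tau> b" using ab by simp
      then show False using descent affine_mult[OF \<tau>, of n m] affine_mult[OF \<tau>, of "n - 1" m] m
        by (simp add: algebra_simps)
    qed
    then show "f p \<in> invs k \<tau>" using swp_less[OF k ab(1)] ab N_inv by (simp add: f_def p)
    show "f p \<notin> {N (n - 1, n)}"
    proof
      assume "f p \<in> {N (n - 1, n)}"
      then obtain m where "a = swp k n (n - 1) + int k * m" "b = swp k n n + int k * m"
        using unswap p by blast
      moreover have "swp k n (n - 1) = n" "swp k n n = n - 1"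
        using consecutive_not_both_multiples[OF k, of n n] by (auto simp: swp_def)
      ultimately show False using ab by simp
    qed
  qed
  ultimately have "card (invs k (\<tau> \<circ> swp k n)) \<le> card (invs k \<tau> - {N (n - 1, n)})"
    using finite_invs[OF \<tau>] by (intro card_inj_on_le) auto
  also have "\<dots> < card (invs k \<tau>)"
    using N_inv[of "n - 1" n] descent finite_invs[OF \<tau>] by (intro psubset_card_mono) auto
  finally show ?thesis .
qed

text \<open>A nondecreasing bijection of the integers cannot skip the value after
  \<open>\<tau> n\<close>, so consecutive values differ by exactly one. These permutations without
  descents are where the factorization into swaps ends.\<close>

lemma affine_increasing_shift:
  assumes \<tau>: "affine k \<tau>" and inc: "\<And>n. \<tau> (n - 1) \<le> \<tau> n"
  shows "\<exists>t. \<forall>n. \<tau> n = n + t"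
proof -
  have mono: "\<tau> a \<le> \<tau> b" if "a \<le> b" for a b
    using that
  proof (induction b rule: int_ge_induct)
    case (step i) then show ?case using inc[of "i + 1"] by simp
  qed simp
  have step: "\<tau> (n + 1) = \<tau> n + 1" for n
  proof -
    obtain m where m: "\<tau> m = \<tau> n + 1" using \<tau> unfolding affine_def by (metis bij_pointE)
    then have "n < m" using mono[of m n] by force
    then have "\<tau> (n + 1) \<le> \<tau> m" using mono by simp
    moreover have "\<tau> n < \<tau> (n + 1)" using mono[of n "n + 1"] affine_inj[OF \<tau>, of n "n + 1"] by simp
    ultimately show ?thesis using m by simp
  qed
  have "\<tau> n = n + \<tau> 0" for n
  proof (induction n rule: int_induct[where k = 0])
    case (step2 i) then show ?case using step[of "i - 1"] by simp
  qed (use step in auto)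
  then show ?thesis by blast
qed

text \<open>Induction on the number of inversions: a swap removes a descent, the induction
  hypothesis handles the shorter permutation, and a bump accounts for the swap. \<open>F'\<close>
  dominates the min-plus product of \<open>F\<close> with \<open>cnt \<tau>\<close>. The linear
  formula for \<open>cnt\<close> far from the diagonal pins down the translation \<open>t\<close>,
  and the bound by \<open>k\<close> keeps the weight at most \<open>k - 2\<close> before each
  bump.\<close>

lemma affine_action:
  assumes "affine k \<tau>" and F: "profile c F"
    and "weight c F + int (card (invs k \<tau>)) < int k"
    and "\<And>a b. b \<le> a - K \<Longrightarrow> cnt \<tau> a b = a - t - b"
  shows "\<exists>F'. profile (c - t) F' \<and> weight (c - t) F' \<le> weight c F + int (card (invs k \<tau>)) \<and>
    (\<forall>b. \<exists>a. F a + cnt \<tau> a b \<le> F' b)"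
  using assms(1,3,4)
proof (induction "card (invs k \<tau>)" arbitrary: \<tau> K rule: less_induct)
  case less
  note \<tau> = less.prems(1) and tail = less.prems(3)
  show ?case
  proof (cases "\<exists>n. \<tau> n < \<tau> (n - 1)")
    case False
    then obtain t' where t': "\<And>n. \<tau> n = n + t'"
      using affine_increasing_shift[OF \<tau>] by (meson not_le)
    have c0: "cnt \<tau> a b = max 0 (a - t' - b)" for a b
    proof -
      have "{n. b \<le> n \<and> \<tau> n < a} = {b..<a - t'}" using t' by auto
      then show ?thesis by (simp add: cnt_def)
    qed
    have "t' = t" using c0[of "max K t'" "min 0 (max K t' - K)"] tail[of "min 0 (max K t' - K)" "max K t'"]
      by auto
    show ?thesis
    proof (intro exI conjI allI)
      show "profile (c - t) (\<lambda>b. F (b + t))" by (rule profile_shift[OF F])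
      show "weight (c - t) (\<lambda>b. F (b + t)) \<le> weight c F + int (card (invs k \<tau>))"
        by (simp add: weight_shift)
      show "F (b + t) + cnt \<tau> (b + t) b \<le> F (b + t)" for b using c0 \<open>t' = t\<close> by simp
    qed
  next
    case True
    then obtain n where n: "\<tau> n < \<tau> (n - 1)" by blast
    \<comment> \<open>For \<open>k = 1\<close> periodicity makes \<open>\<tau>\<close> increase by
      one at every step, which excludes a descent.\<close>
    have k: "2 \<le> k"
    proof (rule ccontr)
      assume "\<not> 2 \<le> k"
      then have "k = 1" using \<tau> by (simp add: affine_def)
      then have "\<tau> n = \<tau> (n - 1) + 1" using affine_mult[OF \<tau>, of "n - 1" 1] by simp
      then show False using n by simp
    qed
    let ?\<sigma> = "\<tau> \<circ> swp k n"
    have \<sigma>: "affine k ?\<sigma>" by (rule affine_swp[OF \<tau> k])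
    have card: "card (invs k ?\<sigma>) < card (invs k \<tau>)" by (rule card_invs_swp[OF \<tau> k n])
    have w: "weight c F + int (card (invs k ?\<sigma>)) < int k" using card less.prems(2) by simp
    \<comment> \<open>At \<open>b\<close> congruent to \<open>n\<close> the count is only known at
      \<open>b - 1\<close> and \<open>b + 1\<close>; these values differ by 2, so both unit steps
      occur. Using \<open>b + 1\<close> costs one in the bound \<open>K\<close>.\<close>
    have tail': "cnt ?\<sigma> a b = a - t - b" if b: "b \<le> a - (K + 1)" for a b
    proof (cases "(b - n) mod int k = 0")
      case True
      have 1: "(b + 1 - n) mod int k \<noteq> 0" using consecutive_not_both_multiples[OF k True] .
      have 2: "(b - 1 - n) mod int k \<noteq> 0"
        using consecutive_not_both_multiples[OF k, of "b - 1" n] True by auto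
      have "cnt ?\<sigma> a (b + 1) = a - t - (b + 1)" "cnt ?\<sigma> a (b - 1) = a - t - (b - 1)"
        unfolding cnt_swp[OF k 1] cnt_swp[OF k 2] using b by (auto intro: tail)
      then show ?thesis using cnt_step[OF \<sigma>, of a b] cnt_step[OF \<sigma>, of a "b - 1"]
        by (auto split: if_splits)
    next
      case False
      then show ?thesis using b cnt_swp[OF k] by (simp add: tail)
    qed
    obtain F1 where F1: "profile (c - t) F1"
      "weight (c - t) F1 \<le> weight c F + int (card (invs k ?\<sigma>))"
      "\<And>b. \<exists>a. F a + cnt ?\<sigma> a b \<le> F1 b"
      using less.hyps[OF card \<sigma> w tail'] by blast
    have w1: "weight (c - t) F1 + 2 \<le> int k" using F1(2) card less.prems(2) by linarith
    \<comment> \<open>At \<open>b\<close> congruent to \<open>n\<close> the counts of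
      \<open>\<tau>\<close> and of the swapped permutation agree at \<open>b - 1\<close> and
      \<open>b + 1\<close>. Going from \<open>b + 1\<close> to \<open>b\<close> adds at most one and
      going from \<open>b - 1\<close> to \<open>b\<close> adds nothing, which gives the two terms of
      the minimum in \<open>bump\<close>.\<close>
    have "\<exists>a. F a + cnt \<tau> a b \<le> bump k n F1 b" for b
    proof (cases "(b - n) mod int k = 0")
      case True
      have 1: "(b + 1 - n) mod int k \<noteq> 0" using consecutive_not_both_multiples[OF k True] .
      have 2: "(b - 1 - n) mod int k \<noteq> 0"
        using consecutive_not_both_multiples[OF k, of "b - 1" n] True by auto
      obtain a1 where "F a1 + cnt \<tau> a1 (b + 1) \<le> F1 (b + 1)" using F1(3) cnt_swp[OF k 1] by metis
      then have a1: "F a1 + cnt \<tau> a1 b \<le> F1 (b + 1) + 1" using cnt_step[OF \<tau>, of a1 b] by auto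
      obtain a2 where "F a2 + cnt \<tau> a2 (b - 1) \<le> F1 (b - 1)" using F1(3) cnt_swp[OF k 2] by metis
      then have a2: "F a2 + cnt \<tau> a2 b \<le> F1 (b - 1)"
        using cnt_step[OF \<tau>, of a2 "b - 1"] by (auto split: if_splits)
      show ?thesis using a1 a2 True by (cases "F1 (b - 1) \<le> F1 (b + 1) + 1") (auto simp: bump_def min_def)
    next
      case False
      then show ?thesis using F1(3)[of b] cnt_swp[OF k False] by (auto simp: bump_def)
    qed
    moreover have "weight (c - t) (bump k n F1) \<le> weight c F + int (card (invs k \<tau>))"
      using weight_bump[OF F1(1) w1 k, of n] F1(2) card by linarith
    ultimately show ?thesis using profile_bump[OF F1(1) k, of n] by blast
  qed
qed

section \<open>Rank and Riemann's theorem on graphs\<close>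

text \<open>The chip change at \<open>x\<close> after firing each vertex \<open>y\<close>
  \<open>c y\<close> times, summed edge by edge; in this form adding a constant to \<open>c\<close>
  visibly has no effect.\<close>

definition lap :: "'v graph \<Rightarrow> ('v \<Rightarrow> int) \<Rightarrow> 'v \<Rightarrow> int" where
  "lap G c x = (\<Sum>y\<in>verts G. (c y - c x) * int (mult G y x))"

lemma graphD:
  assumes "is_graph G"
  shows "finite (verts G)" "verts G \<noteq> {}" "mult G x y = mult G y x" "mult G x x = 0"
    "0 < mult G x y \<Longrightarrow> x \<in> verts G \<and> y \<in> verts G"
    "x \<in> verts G \<Longrightarrow> y \<in> verts G \<Longrightarrow> (x, y) \<in> {(a, b). 0 < mult G a b}\<^sup>*"
  using assms unfolding is_graph_def by blast+

lemma sum_fire: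
  assumes G: "is_graph G" and x: "x \<in> verts G"
  shows "(\<Sum>w\<in>verts G. c w * fire G w x) = lap G c x"
proof -
  have f: "c w * fire G w x = c w * int (mult G w x) - (if w = x then c x * int (val G x) else 0)" for w
    using graphD(4)[OF G] by (auto simp: fire_def)
  have "(\<Sum>w\<in>verts G. c w * fire G w x) = (\<Sum>w\<in>verts G. c w * int (mult G w x)) - c x * int (val G x)"
    unfolding f using x graphD(1)[OF G] by (simp add: sum_subtractf)
  also have "int (val G x) = (\<Sum>w\<in>verts G. int (mult G w x))"
    unfolding val_def using graphD(3)[OF G] by simp
  finally show ?thesis by (simp add: lap_def left_diff_distrib sum_subtractf sum_distrib_left)
qed

lemma lap_diff: "lap G (\<lambda>x. c x - d x) x = lap G c x - lap G d x"
  unfolding lap_def sum_subtractf[symmetric] by (rule sum.cong) (auto simp: algebra_simps)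

lemma lap_add: "lap G (\<lambda>x. c x + d x) x = lap G c x + lap G d x"
  unfolding lap_def sum.distrib[symmetric] by (rule sum.cong) (auto simp: algebra_simps)

lemma sum_lap:
  assumes "is_graph G" shows "(\<Sum>x\<in>verts G. lap G c x) = 0"
proof -
  have "(\<Sum>x\<in>verts G. lap G c x) = (\<Sum>y\<in>verts G. \<Sum>x\<in>verts G. (c y - c x) * int (mult G y x))"
    unfolding lap_def by (rule sum.swap)
  also have "\<dots> = - (\<Sum>y\<in>verts G. lap G c y)"
    unfolding lap_def sum_negf[symmetric]
    by (intro sum.cong refl) (simp add: graphD(3)[OF assms] algebra_simps)
  finally show ?thesis by simp
qed

lemma lin_equiv_iff:
  "is_graph G \<Longrightarrow> lin_equiv G D D' \<longleftrightarrow> (\<exists>c. \<forall>x\<in>verts G. D' x = D x + lap G c x)"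
  by (simp add: lin_equiv_def sum_fire)

lemma linsys_iff:
  assumes "is_graph G"
  shows "linsys_nonempty G D \<longleftrightarrow> (\<exists>c. \<forall>x\<in>verts G. 0 \<le> D x + lap G c x)"
proof
  assume "linsys_nonempty G D"
  then show "\<exists>c. \<forall>x\<in>verts G. 0 \<le> D x + lap G c x"
    unfolding linsys_nonempty_def lin_equiv_iff[OF assms] effective_def by metis
next
  assume "\<exists>c. \<forall>x\<in>verts G. 0 \<le> D x + lap G c x"
  then obtain c where "\<forall>x\<in>verts G. 0 \<le> D x + lap G c x" by blast
  then show "linsys_nonempty G D"
    unfolding linsys_nonempty_def lin_equiv_iff[OF assms]
    by (intro exI[of _ "\<lambda>x. if x \<in> verts G then D x + lap G c x else 0"])
      (auto simp: is_divisor_def effective_def)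
qed

lemma linsys_mono:
  assumes "is_graph G" "linsys_nonempty G D" "\<And>x. x \<in> verts G \<Longrightarrow> D x \<le> D' x"
  shows "linsys_nonempty G D'"
proof -
  obtain c where "\<forall>x\<in>verts G. 0 \<le> D x + lap G c x" using assms linsys_iff by blast
  then have "\<forall>x\<in>verts G. 0 \<le> D' x + lap G c x" using assms(3) by force
  then show ?thesis using assms linsys_iff by blast
qed

lemma linsys_equiv:
  assumes G: "is_graph G" and "\<And>x. x \<in> verts G \<Longrightarrow> D' x = D x + lap G c x"
  shows "linsys_nonempty G D' \<longleftrightarrow> linsys_nonempty G D"
proof
  assume "linsys_nonempty G D'"
  then obtain d where "\<forall>x\<in>verts G. 0 \<le> D' x + lap G d x" using linsys_iff[OF G] by blast
  then have "\<forall>x\<in>verts G. 0 \<le> D x + lap G (\<lambda>x. c x + d x) x" using assms(2) by (simp add: lap_add add.assoc)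
  then show "linsys_nonempty G D" using linsys_iff[OF G] by blast
next
  assume "linsys_nonempty G D"
  then obtain d where "\<forall>x\<in>verts G. 0 \<le> D x + lap G d x" using linsys_iff[OF G] by blast
  then have "\<forall>x\<in>verts G. 0 \<le> D' x + lap G (\<lambda>x. d x - c x) x" using assms(2) by (simp add: lap_diff)
  then show "linsys_nonempty G D'" using linsys_iff[OF G] by blast
qed

lemma linsys_deg_nonneg:
  assumes G: "is_graph G" and "linsys_nonempty G D" shows "0 \<le> deg G D"
proof -
  obtain c where "\<forall>x\<in>verts G. 0 \<le> D x + lap G c x" using assms linsys_iff by blast
  then have "0 \<le> (\<Sum>x\<in>verts G. D x + lap G c x)" by (simp add: sum_nonneg)
  then show ?thesis by (simp add: sum.distrib sum_lap[OF G] deg_def)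
qed

lemma sum_ind: "finite S \<Longrightarrow> v \<in> S \<Longrightarrow> (\<Sum>x\<in>S. a * ind v x) = a"
proof -
  have "a * ind v x = (if x = v then a else 0)" for x by (simp add: ind_def)
  then show "finite S \<Longrightarrow> v \<in> S \<Longrightarrow> ?thesis" by simp
qed

lemma deg_add_ind:
  assumes "is_graph G" "v \<in> verts G"
  shows "deg G (\<lambda>x. D x + a * ind v x) = deg G D + a"
  using sum_ind[of "verts G" v a] graphD(1)[OF assms(1)] assms(2) by (simp add: deg_def sum.distrib)

text \<open>The property maximized in \<open>rank\<close> is inherited by smaller \<open>r\<close>,
  since \<open>E\<close> can be padded with chips at one vertex, and it bounds \<open>r\<close> by
  the degree. So the greatest \<open>r\<close> exists and the rank can be tested one
  \<open>r\<close> at a time.\<close>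

lemma rank_ge_iff:
  assumes G: "is_graph G"
  shows "int r \<le> rank G D \<longleftrightarrow> (\<forall>E. is_divisor G E \<and> effective G E \<and> deg G E = int r \<longrightarrow>
           linsys_nonempty G (\<lambda>x. D x - E x))"
proof -
  define P where "P r \<longleftrightarrow> (\<forall>E. is_divisor G E \<and> effective G E \<and> deg G E = int r \<longrightarrow>
      linsys_nonempty G (\<lambda>x. D x - E x))" for r :: nat
  obtain q where q: "q \<in> verts G" using graphD(2)[OF G] by blast
  have P_le: "P r'" if P: "P r" and le: "r' \<le> r" for r r'
    unfolding P_def
  proof (intro allI impI)
    fix E assume E: "is_divisor G E \<and> effective G E \<and> deg G E = int r'"
    let ?E = "\<lambda>x. E x + int (r - r') * ind q x"
    have "is_divisor G ?E" using E q by (auto simp: is_divisor_def ind_def)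
    moreover have "effective G ?E" using E by (auto simp: effective_def ind_def)
    moreover have "deg G ?E = int r" using E le deg_add_ind[OF G q] by simp
    ultimately have "linsys_nonempty G (\<lambda>x. D x - ?E x)" using P unfolding P_def by blast
    then show "linsys_nonempty G (\<lambda>x. D x - E x)"
      by (rule linsys_mono[OF G]) (simp add: ind_def)
  qed
  have P0: "P 0 \<longleftrightarrow> linsys_nonempty G D"
  proof
    assume "P 0"
    moreover have "is_divisor G (\<lambda>x. 0) \<and> effective G (\<lambda>x. 0) \<and> deg G (\<lambda>x. 0) = int 0"
      by (simp add: is_divisor_def effective_def deg_def)
    ultimately have "linsys_nonempty G (\<lambda>x. D x - 0)" unfolding P_def by blast
    then show "linsys_nonempty G D" by simp
  next
    assume L: "linsys_nonempty G D"
    show "P 0" unfolding P_def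
    proof (intro allI impI)
      fix E assume E: "is_divisor G E \<and> effective G E \<and> deg G E = int 0"
      then have "\<forall>x\<in>verts G. E x = 0"
        unfolding deg_def effective_def using sum_nonneg_eq_0_iff[OF graphD(1)[OF G], of E] by simp
      then show "linsys_nonempty G (\<lambda>x. D x - E x)" by (intro linsys_mono[OF G L]) simp
    qed
  qed
  have bound: "r \<le> nat (deg G D)" if "P r" for r
  proof -
    let ?E = "\<lambda>x. 0 + int r * ind q x"
    have "is_divisor G ?E" using q by (auto simp: is_divisor_def ind_def)
    moreover have "effective G ?E" by (auto simp: effective_def ind_def)
    moreover have "deg G ?E = int r" unfolding deg_add_ind[OF G q] by (simp add: deg_def)
    ultimately have "linsys_nonempty G (\<lambda>x. D x - ?E x)" using that unfolding P_def by blast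
    then have "0 \<le> deg G (\<lambda>x. D x - ?E x)" by (rule linsys_deg_nonneg[OF G])
    also have "\<dots> = deg G D - int r" using deg_add_ind[OF G q, of D "- int r"] by simp
    finally show ?thesis by simp
  qed
  have "int r \<le> rank G D \<longleftrightarrow> P r"
  proof (cases "linsys_nonempty G D")
    case False
    then show ?thesis using P0 P_le[of r 0] by (auto simp: rank_def)
  next
    case True
    have rk: "rank G D = int (GREATEST r. P r)" using True by (simp add: rank_def P_def)
    have "P (GREATEST r. P r)"
      by (rule GreatestI_nat[of P 0 "nat (deg G D)"]) (use P0 True bound in auto)
    moreover have "r \<le> (GREATEST r. P r)" if "P r"
      by (rule Greatest_le_nat[of P r "nat (deg G D)"]) (use that bound in auto)
    ultimately show ?thesis unfolding rk of_nat_le_iff using P_le[of "GREATEST r. P r" r] by argo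
  qed
  then show ?thesis by (simp add: P_def)
qed

lemma rank_ge_minus1: "-1 \<le> rank G D"
  by (simp add: rank_def)

lemma rank_leI:
  assumes "\<And>r. int r \<le> rank G D \<Longrightarrow> int r \<le> R" and "-1 \<le> R"
  shows "rank G D \<le> R"
proof (cases "rank G D = -1")
  case False
  then have "0 \<le> rank G D" using rank_ge_minus1[of G D] by linarith
  then show ?thesis using assms(1)[of "nat (rank G D)"] by simp
qed (use assms in simp)

lemma rank_equiv:
  assumes G: "is_graph G" and "\<And>x. x \<in> verts G \<Longrightarrow> D' x = D x + lap G c x"
  shows "rank G D' = rank G D"
proof -
  have "linsys_nonempty G (\<lambda>x. D' x - E x) \<longleftrightarrow> linsys_nonempty G (\<lambda>x. D x - E x)" for E
    by (rule linsys_equiv[OF G, of _ _ c]) (use assms(2) in simp)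
  then show ?thesis using linsys_equiv[OF G assms(2)] by (simp add: rank_def)
qed

lemma rank_cong:
  "is_graph G \<Longrightarrow> (\<And>x. x \<in> verts G \<Longrightarrow> D' x = D x) \<Longrightarrow> rank G D' = rank G D"
  by (rule rank_equiv[where c = "\<lambda>_. 0"]) (auto simp: lap_def)

lemma rank_add_vertex:
  assumes G: "is_graph G" and v: "v \<in> verts G" and D': "\<And>x. x \<in> verts G \<Longrightarrow> D' x = D x + ind v x"
  shows "rank G D \<le> rank G D'" "rank G D' \<le> rank G D + 1"
proof -
  show "rank G D \<le> rank G D'"
  proof (rule rank_leI[OF _ rank_ge_minus1])
    fix r assume "int r \<le> rank G D"
    moreover have "linsys_nonempty G (\<lambda>x. D' x - E x)" if "linsys_nonempty G (\<lambda>x. D x - E x)" for E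
      by (rule linsys_mono[OF G that]) (simp add: D' ind_def)
    ultimately show "int r \<le> rank G D'" unfolding rank_ge_iff[OF G] by blast
  qed
  show "rank G D' \<le> rank G D + 1"
  proof (rule rank_leI)
    fix r assume r: "int r \<le> rank G D'"
    show "int r \<le> rank G D + 1"
    proof (cases r)
      case (Suc s)
      have "int s \<le> rank G D"
        unfolding rank_ge_iff[OF G]
      proof (intro allI impI)
        fix E assume E: "is_divisor G E \<and> effective G E \<and> deg G E = int s"
        let ?E = "\<lambda>x. E x + 1 * ind v x"
        have "is_divisor G ?E" using E v by (auto simp: is_divisor_def ind_def)
        moreover have "effective G ?E" using E by (auto simp: effective_def ind_def)
        moreover have "deg G ?E = int r" using E Suc unfolding deg_add_ind[OF G v] by simp
        ultimately have "linsys_nonempty G (\<lambda>x. D' x - ?E x)" using r unfolding rank_ge_iff[OF G] by blast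
        then show "linsys_nonempty G (\<lambda>x. D x - E x)" by (rule linsys_mono[OF G]) (simp add: D')
      qed
      then show ?thesis using Suc by simp
    qed (use rank_ge_minus1[of G D] in simp)
  qed (use rank_ge_minus1[of G D] in simp)
qed

lemma rank_neg_deg: "is_graph G \<Longrightarrow> deg G D < 0 \<Longrightarrow> rank G D = -1"
  using linsys_deg_nonneg[of G D] by (auto simp: rank_def)

section \<open>Edge counts and a divisor of degree \<open>g - 1\<close> without effective
  representative\<close>

lemma double_num_edges:
  assumes G: "is_graph G"
  shows "(\<Sum>x\<in>verts G. \<Sum>y\<in>verts G. int (mult G x y)) = 2 * int (num_edges G)"
proof -
  \<comment> \<open>An injective numbering of the vertices splits the ordered pairs into two halves
    exchanged by symmetry. The total is therefore even and \<open>div 2\<close> loses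
    nothing.\<close>
  obtain f :: "'a \<Rightarrow> nat" where f: "inj_on f (verts G)"
    using finite_imp_inj_to_nat_seg[OF graphD(1)[OF G]] by blast
  let ?A = "\<Sum>x\<in>verts G. \<Sum>y\<in>verts G. if f y < f x then mult G x y else 0"
  have "(\<Sum>x\<in>verts G. \<Sum>y\<in>verts G. mult G x y) =
     (\<Sum>x\<in>verts G. \<Sum>y\<in>verts G. (if f y < f x then mult G x y else 0) + (if f x < f y then mult G x y else 0))"
    using f graphD(4)[OF G] by (intro sum.cong refl) (auto simp: inj_on_def not_less dest: le_antisym)
  also have "\<dots> = ?A + (\<Sum>x\<in>verts G. \<Sum>y\<in>verts G. if f x < f y then mult G x y else 0)"
    by (simp add: sum.distrib)
  also have "(\<Sum>x\<in>verts G. \<Sum>y\<in>verts G. if f x < f y then mult G x y else 0) = ?A"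
    by (subst sum.swap) (intro sum.cong refl, simp add: graphD(3)[OF G])
  finally have "(\<Sum>x\<in>verts G. \<Sum>y\<in>verts G. mult G x y) = 2 * ?A" by simp
  then have "(\<Sum>x\<in>verts G. \<Sum>y\<in>verts G. mult G x y) = 2 * num_edges G" unfolding num_edges_def by simp
  then show ?thesis by (metis (mono_tags, lifting) of_nat_sum of_nat_mult of_nat_numeral sum.cong)
qed

text \<open>For a total order on the vertices, the divisor \<open>x \<mapsto> (number of edges to smaller vertices) - 1\<close>
  is not equivalent to an effective one: whatever the firing script, the smallest vertex among those
  fired most often ends in debt.\<close>

lemma exists_noneffective:
  assumes G: "is_graph G"
  shows "\<exists>N. deg G N = genus G - 1 \<and> \<not> linsys_nonempty G N"
proof -
  let ?V = "verts G"
  have fin: "finite ?V" by (rule graphD(1)[OF G])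
  obtain f :: "'a \<Rightarrow> nat" where f: "inj_on f ?V"
    using finite_imp_inj_to_nat_seg[OF fin] by blast
  define N where "N x = (\<Sum>y\<in>?V. if f y < f x then int (mult G y x) else 0) - 1" for x
  let ?A = "\<Sum>x\<in>?V. \<Sum>y\<in>?V. if f y < f x then int (mult G y x) else 0"
  have "2 * int (num_edges G) =
     (\<Sum>x\<in>?V. \<Sum>y\<in>?V. (if f y < f x then int (mult G y x) else 0) + (if f x < f y then int (mult G y x) else 0))"
    unfolding double_num_edges[OF G, symmetric]
    using f graphD(4)[OF G] by (intro sum.cong refl)
      (auto simp: inj_on_def not_less graphD(3)[OF G] dest: le_antisym)
  also have "\<dots> = ?A + (\<Sum>x\<in>?V. \<Sum>y\<in>?V. if f x < f y then int (mult G y x) else 0)"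
    by (simp add: sum.distrib)
  also have "(\<Sum>x\<in>?V. \<Sum>y\<in>?V. if f x < f y then int (mult G y x) else 0) = ?A"
    by (subst sum.swap) (intro sum.cong refl, simp add: graphD(3)[OF G])
  finally have "?A = int (num_edges G)" by simp
  then have "deg G N = genus G - 1" by (simp add: deg_def N_def genus_def sum_subtractf)
  moreover have "\<not> linsys_nonempty G N"
  proof
    assume "linsys_nonempty G N"
    then obtain c where c: "\<And>x. x \<in> ?V \<Longrightarrow> 0 \<le> N x + lap G c x" using linsys_iff[OF G] by blast
    define M where "M = {x\<in>?V. c x = Max (c ` ?V)}"
    have le: "c y \<le> Max (c ` ?V)" if "y \<in> ?V" for y using fin that by simp
    have "Max (c ` ?V) \<in> c ` ?V" using fin graphD(2)[OF G] by (intro Max_in) auto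
    then have "M \<noteq> {}" "finite M" using fin by (auto simp: M_def)
    then have "Min (f ` M) \<in> f ` M" by (intro Min_in) auto
    then obtain x where x: "x \<in> M" "f x = Min (f ` M)" by force
    then have xV: "x \<in> ?V" "c x = Max (c ` ?V)" by (auto simp: M_def)
    have "(c y - c x) * int (mult G y x) + (if f y < f x then int (mult G y x) else 0) \<le> 0"
      if y: "y \<in> ?V" for y
    proof (cases "y \<in> M")
      case True
      then have "f x \<le> f y" using x \<open>finite M\<close> by simp
      then show ?thesis using True x by (auto simp: M_def)
    next
      case False
      then have "c y - c x \<le> -1" using le[OF y] y xV by (auto simp: M_def)
      then have "(c y - c x) * int (mult G y x) \<le> -1 * int (mult G y x)" by (intro mult_right_mono) auto
      then show ?thesis by auto
    qed
    then have "(\<Sum>y\<in>?V. (c y - c x) * int (mult G y x) + (if f y < f x then int (mult G y x) else 0)) \<le> 0"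
      by (rule sum_nonpos)
    then have "N x + lap G c x \<le> -1" by (simp add: N_def lap_def sum.distrib)
    then show False using c[OF xV(1)] by simp
  qed
  ultimately show ?thesis by blast
qed

text \<open>Maximum principle: at a vertex where \<open>c\<close> is maximal all summands of the
  vanishing sum have the same sign, so \<open>c\<close> is maximal at every neighbour too, and
  connectedness spreads this to all vertices.\<close>

lemma lap_kernel_constant:
  assumes G: "is_graph G" and c: "\<And>x. x \<in> verts G \<Longrightarrow> lap G c x = 0"
    and "x \<in> verts G" "y \<in> verts G"
  shows "c x = c y"
proof -
  let ?V = "verts G"
  have fin: "finite ?V" by (rule graphD(1)[OF G])
  let ?M = "Max (c ` ?V)"
  have "?M \<in> c ` ?V" using fin graphD(2)[OF G] by (intro Max_in) auto
  then obtain z where z: "z \<in> ?V" "c z = ?M" by force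
  have max_step: "c b = ?M" if ca: "c a = ?M" and m: "0 < mult G a b" for a b
  proof -
    have V: "a \<in> ?V" "b \<in> ?V" using graphD(5)[OF G m] by auto
    have "(\<Sum>y\<in>?V. (c a - c y) * int (mult G y a)) = - lap G c a"
      by (simp add: lap_def sum_negf[symmetric] algebra_simps)
    then have "(\<Sum>y\<in>?V. (c a - c y) * int (mult G y a)) = 0" using c[OF V(1)] by simp
    moreover have "0 \<le> (c a - c y) * int (mult G y a)" if "y \<in> ?V" for y
      using fin ca that by simp
    ultimately have "(c a - c b) * int (mult G b a) = 0"
      using sum_nonneg_eq_0_iff[OF fin, of "\<lambda>y. (c a - c y) * int (mult G y a)"] V by simp
    then show ?thesis using m ca graphD(3)[OF G, of a b] by simp
  qed
  have "c w = ?M" if "w \<in> ?V" for w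
    using graphD(6)[OF G z(1) that]
  proof (induction rule: rtrancl_induct)
    case (step a b)
    then have "0 < mult G a b" by simp
    then show ?case by (rule max_step[OF step.IH])
  qed (use z in simp)
  then show ?thesis using assms by simp
qed

section \<open>Dhar's burning algorithm and Riemann's inequality\<close>

inductive burnt :: "'v graph \<Rightarrow> ('v \<Rightarrow> int) \<Rightarrow> 'v set \<Rightarrow> bool" for G D where
  empty: "burnt G D {}"
| burn: "burnt G D S \<Longrightarrow> x \<in> verts G \<Longrightarrow> x \<notin> S \<Longrightarrow> D x < (\<Sum>y\<in>S. int (mult G y x)) \<Longrightarrow>
    burnt G D (insert x S)"

text \<open>When \<open>x\<close> joins the burnt set \<open>S\<close>, \<open>D x + 1\<close> is at
  most the number of edges from \<open>x\<close> to \<open>S\<close>; adding this up counts every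
  edge inside the final set once. The fire starts at a vertex in debt, where the sum over the empty
  set is 0.\<close>

lemma burnt_bound:
  assumes G: "is_graph G" and "burnt G D S"
  shows "S \<subseteq> verts G \<and> 2 * ((\<Sum>x\<in>S. D x) + int (card S)) \<le> (\<Sum>x\<in>S. \<Sum>y\<in>S. int (mult G x y))"
  using assms(2)
proof induction
  case (burn S x)
  then have fin: "finite S" using finite_subset graphD(1)[OF G] by blast
  have "(\<Sum>z\<in>insert x S. \<Sum>y\<in>insert x S. int (mult G z y)) =
     (\<Sum>y\<in>S. int (mult G x y)) + ((\<Sum>z\<in>S. int (mult G z x)) + (\<Sum>z\<in>S. \<Sum>y\<in>S. int (mult G z y)))"
    using fin burn graphD(4)[OF G] by (simp add: sum.distrib)
  also have "(\<Sum>y\<in>S. int (mult G x y)) = (\<Sum>z\<in>S. int (mult G z x))"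
    by (simp add: graphD(3)[OF G])
  finally show ?case using burn fin by simp
qed simp

lemma maximal_burnt:
  assumes G: "is_graph G"
  shows "\<exists>S. burnt G D S \<and> (\<forall>x\<in>verts G - S. (\<Sum>y\<in>S. int (mult G y x)) \<le> D x)"
proof -
  have "card S \<le> card (verts G)" if "burnt G D S" for S
    using burnt_bound[OF G that] graphD(1)[OF G] by (simp add: card_mono)
  then obtain S where S: "burnt G D S" "\<And>T. burnt G D T \<Longrightarrow> card T \<le> card S"
    using ex_has_greatest_nat[of "burnt G D" "{}" card "Suc (card (verts G))"] burnt.empty
    by (metis le_imp_less_Suc)
  have fin: "finite S" using burnt_bound[OF G S(1)] graphD(1)[OF G] finite_subset by blast
  have "(\<Sum>y\<in>S. int (mult G y x)) \<le> D x" if "x \<in> verts G - S" for x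
    using burnt.burn[OF S(1), of x] S(2)[of "insert x S"] that fin by force
  then show ?thesis using S(1) by blast
qed

text \<open>Among the divisors equivalent to \<open>D\<close> take one with the least total debt and, with that debt and a
  vertex \<open>q\<close> in debt fixed, the largest firing script. If the fire of the burning algorithm does
  not consume the whole graph, then firing the unburnt set contradicts maximality; if it does, the
  degree is less than the genus.\<close>

lemma riemann_effective:
  assumes G: "is_graph G" and deg: "genus G \<le> deg G D"
  shows "linsys_nonempty G D"
proof (rule ccontr)
  assume neg: "\<not> linsys_nonempty G D"
  let ?V = "verts G"
  have fin: "finite ?V" by (rule graphD(1)[OF G])
  define D' where "D' c x = D x + lap G c x" for c x
  define debt where "debt c = (\<Sum>x\<in>?V. nat (- D' c x))" for c
  obtain c0 where c0: "\<And>c. debt c0 \<le> debt c"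
    using ex_has_least_nat[of "\<lambda>_. True" _ debt] by blast
  obtain q where q: "q \<in> ?V" "D' c0 q < 0"
    using neg linsys_iff[OF G] unfolding D'_def by (meson not_le)
  \<comment> \<open>Scripts that differ by a constant have the same effect; \<open>c q = 0\<close>
    picks one of them.\<close>
  define A where "A = {c. (\<forall>x. x \<notin> ?V \<longrightarrow> c x = 0) \<and> c q = 0 \<and> debt c = debt c0 \<and> D' c q < 0}"
  have D'_cong: "D' c x = D' d x" if "\<And>y. y \<in> ?V \<Longrightarrow> c y = d y + e" "x \<in> ?V" for c d e x
    unfolding D'_def lap_def using that by simp
  have "(\<lambda>x. if x \<in> ?V then c0 x - c0 q else 0) \<in> A" (is "?c \<in> A")
  proof -
    have "D' ?c x = D' c0 x" if "x \<in> ?V" for x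
      by (rule D'_cong[where e = "- c0 q"]) (use that in auto)
    then have "debt ?c = debt c0" "D' ?c q < 0" using q by (auto simp: debt_def)
    then show ?thesis using q unfolding A_def by simp
  qed
  then have ne: "A \<noteq> {}" by blast
  have sumD': "(\<Sum>x\<in>?V. D' c x) = deg G D" for c
    by (simp add: D'_def sum.distrib sum_lap[OF G] deg_def)
  let ?B = "?V \<rightarrow>\<^sub>E {- int (debt c0)..deg G D + int (debt c0)}"
  \<comment> \<open>A script in \<open>A\<close> is determined by the resulting divisor, and the
    fixed debt and degree leave only finitely many divisors. So a script with maximal sum
    exists.\<close>
  have "finite A"
  proof (rule inj_on_finite[where f = "\<lambda>c. restrict (D' c) ?V"])
    show "finite ?B" using fin by (intro finite_PiE) auto
    show "inj_on (\<lambda>c. restrict (D' c) ?V) A"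
    proof (rule inj_onI, rule ext)
      fix c d x assume cd: "c \<in> A" "d \<in> A" "restrict (D' c) ?V = restrict (D' d) ?V"
      have "lap G (\<lambda>y. c y - d y) y = 0" if "y \<in> ?V" for y
        using fun_cong[OF cd(3), of y] that by (simp add: lap_diff D'_def)
      then have "x \<in> ?V \<Longrightarrow> c x - d x = c q - d q"
        using lap_kernel_constant[OF G, of "\<lambda>y. c y - d y"] q by blast
      then show "c x = d x" using cd by (cases "x \<in> ?V") (auto simp: A_def)
    qed
    show "(\<lambda>c. restrict (D' c) ?V) ` A \<subseteq> ?B"
    proof (intro image_subsetI restrict_PiE_iff[THEN iffD2] ballI)
      fix c x assume c: "c \<in> A" and x: "x \<in> ?V"
      have "debt c0 = debt c" using c by (simp add: A_def)
      then have d: "int (debt c0) = (\<Sum>y\<in>?V. int (nat (- D' c y)))" unfolding debt_def by simp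
      have "int (nat (- D' c x)) \<le> int (debt c0)"
        unfolding d by (rule member_le_sum) (use x fin in auto)
      moreover have "(\<Sum>y\<in>?V - {x}. - D' c y) \<le> (\<Sum>y\<in>?V - {x}. int (nat (- D' c y)))"
        by (rule sum_mono) simp
      moreover have "\<dots> \<le> int (debt c0)" unfolding d by (rule sum_mono2) (use fin in auto)
      moreover have "D' c x + (\<Sum>y\<in>?V - {x}. D' c y) = deg G D"
        using sumD'[of c] sum.remove[OF fin x, of "D' c"] by simp
      ultimately show "D' c x \<in> {- int (debt c0)..deg G D + int (debt c0)}" by (simp add: sum_negf split: if_splits)
    qed
  qed
  then have fA: "finite ((\<lambda>c. sum c ?V) ` A)" by auto
  then have "Max ((\<lambda>c. sum c ?V) ` A) \<in> (\<lambda>c. sum c ?V) ` A" using ne by (intro Max_in) auto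
  then obtain c where c: "c \<in> A" "sum c ?V = Max ((\<lambda>c. sum c ?V) ` A)" by force
  have max: "sum d ?V \<le> sum c ?V" if "d \<in> A" for d using fA that c(2) by simp
  obtain S where S: "burnt G (D' c) S" "\<And>x. x \<in> ?V - S \<Longrightarrow> (\<Sum>y\<in>S. int (mult G y x)) \<le> D' c x"
    using maximal_burnt[OF G] by blast
  have SV: "S \<subseteq> ?V" using burnt_bound[OF G S(1)] by simp
  show False
  proof (cases "S = ?V")
    case True
    then have "2 * (deg G D + int (card ?V)) \<le> 2 * int (num_edges G)"
      using burnt_bound[OF G S(1)] by (simp add: sumD' double_num_edges[OF G])
    then show False using deg by (simp add: genus_def)
  next
    case False
    define u where "u x = (if x \<in> ?V - S then 1 else 0 :: int)" for x
    define d where "d x = c x + u x" for x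
    have D'd: "D' d x = D' c x + lap G u x" for x unfolding D'_def d_def lap_add by simp
    have ge: "D' c x \<le> D' d x" if "x \<notin> ?V - S" for x
      unfolding D'd using that by (auto simp: lap_def u_def intro!: sum_nonneg)
    have nn: "0 \<le> D' d x" if x: "x \<in> ?V - S" for x
    proof -
      have "lap G u x = (\<Sum>y\<in>?V. if y \<in> S then - int (mult G y x) else 0)"
        unfolding lap_def u_def using x by (intro sum.cong) auto
      also have "\<dots> = - (\<Sum>y\<in>S. int (mult G y x))"
        using SV fin by (simp add: sum.If_cases sum_negf Int_absorb1)
      finally show ?thesis using S(2)[OF x] D'd by simp
    qed
    have le: "nat (- D' d x) \<le> nat (- D' c x)" for x using ge[of x] nn[of x] by (cases "x \<in> ?V - S") auto
    have "debt d \<le> debt c" unfolding debt_def by (rule sum_mono) (rule le)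
    then have dd: "debt d = debt c0" "debt d = debt c" using c0[of d] c(1) by (auto simp: A_def)
    \<comment> \<open>No vertex gains debt and the total debt is already minimal, so the debt at
      \<open>q\<close> is unchanged.\<close>
    have "nat (- D' d q) = nat (- D' c q)"
    proof (rule ccontr)
      assume "nat (- D' d q) \<noteq> nat (- D' c q)"
      then have "nat (- D' d q) < nat (- D' c q)" using le[of q] by linarith
      then have "debt d < debt c" unfolding debt_def
        using le q(1) by (intro sum_strict_mono_ex1[OF fin]) blast+
      then show False using dd by simp
    qed
    moreover have cq: "D' c q < 0" "c q = 0" using c(1) by (auto simp: A_def)
    ultimately have "D' d q < 0" by simp
    moreover have "q \<notin> ?V - S" using S(2)[of q] cq sum_nonneg[of S "\<lambda>y. int (mult G y q)"] by force
    ultimately have "d \<in> A" using dd c(1) unfolding A_def d_def u_def by simp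
    then have "sum u ?V \<le> 0" using max[of d] by (simp add: d_def sum.distrib)
    moreover have "sum u ?V = int (card (?V - S))"
      unfolding u_def using fin by (simp add: sum.If_cases set_diff_eq Int_def)
    ultimately show False using False SV fin by simp
  qed
qed

lemma genus_nonneg:
  assumes "is_graph G" shows "0 \<le> genus G"
proof (rule ccontr)
  obtain q where q: "q \<in> verts G" using graphD(2)[OF assms] by blast
  let ?D = "\<lambda>x. 0 + (-1) * ind q x"
  have d: "deg G ?D = -1" unfolding deg_add_ind[OF assms q] by (simp add: deg_def)
  assume "\<not> 0 \<le> genus G"
  then show False
    using riemann_effective[OF assms, of ?D] linsys_deg_nonneg[OF assms, of ?D] d by simp
qed

lemma rank_ge_deg:
  assumes G: "is_graph G" shows "deg G D - genus G \<le> rank G D"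
proof (cases "0 \<le> deg G D - genus G")
  case True
  have "int (nat (deg G D - genus G)) \<le> rank G D"
    unfolding rank_ge_iff[OF G]
    by (intro allI impI riemann_effective[OF G]) (use True in \<open>simp add: deg_def sum_subtractf\<close>)
  then show ?thesis using True by simp
qed (use rank_ge_minus1[of G D] in linarith)

text \<open>With \<open>N\<close> of degree \<open>g - 1\<close> not equivalent to an effective
  divisor, \<open>D - N\<close> has degree at least \<open>g\<close> and so is equivalent to an
  effective \<open>E\<close>. As \<open>D - E\<close> is equivalent to \<open>N\<close>, the rank is
  less than \<open>deg E = deg D - g + 1\<close>.\<close>

lemma rank_large_deg:
  assumes G: "is_graph G" and deg: "2 * genus G - 1 \<le> deg G D"
  shows "rank G D = deg G D - genus G"
proof (rule antisym)
  obtain N where N: "deg G N = genus G - 1" "\<not> linsys_nonempty G N" using exists_noneffective[OF G] by blast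
  have degd: "deg G (\<lambda>x. D x - N x) = deg G D - genus G + 1" using N by (simp add: deg_def sum_subtractf)
  then have "linsys_nonempty G (\<lambda>x. D x - N x)" using deg by (intro riemann_effective[OF G]) simp
  then obtain c where c: "\<forall>x\<in>verts G. 0 \<le> D x - N x + lap G c x"
    unfolding linsys_iff[OF G] by blast
  define E where "E x = (if x \<in> verts G then D x - N x + lap G c x else 0)" for x
  have degE: "deg G E = deg G D - genus G + 1"
    using degd sum_lap[OF G, of c] by (simp add: E_def deg_def sum.distrib)
  have E: "is_divisor G E" "effective G E" using c by (auto simp: E_def is_divisor_def effective_def)
  have "linsys_nonempty G N \<longleftrightarrow> linsys_nonempty G (\<lambda>x. D x - E x)"
    by (rule linsys_equiv[OF G, of _ _ c]) (simp add: E_def)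
  then have "\<not> linsys_nonempty G (\<lambda>x. D x - E x)" using N by simp
  moreover have "deg G E = int (nat (deg G E))" using degE deg genus_nonneg[OF G] by simp
  ultimately have "\<not> int (nat (deg G E)) \<le> rank G D" using E unfolding rank_ge_iff[OF G] by blast
  then show "rank G D \<le> deg G D - genus G" using degE deg genus_nonneg[OF G] by simp
qed (rule rank_ge_deg[OF G])

section \<open>Transmission permutations\<close>

lemma jump_position:
  fixes p :: "int \<Rightarrow> int"
  assumes step: "\<And>a. p (a - 1) \<le> p a" and range: "\<And>a. 0 \<le> p a \<and> p a \<le> 1"
    and lo: "p lo = 0" and hi: "p hi = 1"
  shows "\<exists>t. \<forall>a. p a = (if t \<le> a then 1 else 0)"
proof -
  have mono: "p a \<le> p b" if "a \<le> b" for a b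
    using that
  proof (induction b rule: int_ge_induct)
    case (step i) then show ?case using assms(1)[of "i + 1"] by simp
  qed simp
  have "lo \<le> hi" using mono[of hi lo] lo hi by linarith
  then have ex: "p (lo + int (nat (hi - lo))) = 1" using hi by simp
  define n where "n = (LEAST n. p (lo + int n) = 1)"
  have n1: "p (lo + int n) = 1" unfolding n_def by (rule LeastI[where P = "\<lambda>n. p (lo + int n) = 1", OF ex])
  have "p a = (if lo + int n \<le> a then 1 else 0)" for a
  proof (cases "lo + int n \<le> a")
    case True
    then show ?thesis using mono[OF True] n1 range[of a] by simp
  next
    case False
    have "p a \<noteq> 1"
    proof
      assume pa: "p a = 1"
      then have "lo \<le> a" using mono[of a lo] lo by linarith
      then have "n \<le> nat (a - lo)" unfolding n_def by (intro Least_le) (simp add: pa)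
      then show False using False \<open>lo \<le> a\<close> by simp
    qed
    then show ?thesis using False range[of a] by simp
  qed
  then show ?thesis by blast
qed

text \<open>Submodularity makes the difference in \<open>b\<close> monotone in \<open>a\<close>, so
  it jumps from 0 to 1 exactly once, at \<open>\<tau> b\<close>. The difference in \<open>a\<close>
  is monotone in \<open>- b\<close> and jumps once, at \<open>\<sigma> a\<close>. Both jumps locate
  the 1 of the same mixed difference, so \<open>\<tau>\<close> and
  \<open>a \<mapsto> - \<sigma> a\<close> are inverse to each other.\<close>

lemma submodular_permutation:
  fixes f :: "int \<Rightarrow> int \<Rightarrow> int"
  assumes s1: "\<And>a b. f (a - 1) b \<le> f a b \<and> f a b \<le> f (a - 1) b + 1"
    and s2: "\<And>a b. f a (b + 1) \<le> f a b \<and> f a b \<le> f a (b + 1) + 1"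
    and low: "\<And>a b. a - b < L \<Longrightarrow> f a b = -1"
    and high: "\<And>a b. H \<le> a - b \<Longrightarrow> f a b = a - b + C"
    and sub: "\<And>a b. 0 \<le> f a b - f (a - 1) b - f a (b + 1) + f (a - 1) (b + 1)"
  shows "\<exists>\<tau>. bij \<tau> \<and> (\<forall>a b. f a b - f a (b + 1) = (if \<tau> b \<le> a then 1 else 0))"
proof -
  have "\<exists>t. \<forall>a. f a b - f a (b + 1) = (if t \<le> a then 1 else 0)" for b
  proof (rule jump_position[where lo = "L + b - 1" and hi = "H + b + 1"])
    show "f (a - 1) b - f (a - 1) (b + 1) \<le> f a b - f a (b + 1)" for a using sub[of a b] by linarith
    show "0 \<le> f a b - f a (b + 1) \<and> f a b - f a (b + 1) \<le> 1" for a using s2[of a b] by linarith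
  qed (simp_all add: low high)
  then obtain \<tau> where \<tau>: "\<And>a b. f a b - f a (b + 1) = (if \<tau> b \<le> a then 1 else 0)" by metis
  have "\<exists>t. \<forall>b. f a (- b) - f (a - 1) (- b) = (if t \<le> b then 1 else 0)" for a
  proof (rule jump_position[where lo = "L - a - 1" and hi = "H - a + 1"])
    show "f a (- (b - 1)) - f (a - 1) (- (b - 1)) \<le> f a (- b) - f (a - 1) (- b)" for b
      using sub[of a "- b"] by simp
    show "0 \<le> f a (- b) - f (a - 1) (- b) \<and> f a (- b) - f (a - 1) (- b) \<le> 1" for b
      using s1[of a "- b"] by linarith
  qed (simp_all add: low high)
  then obtain \<sigma> where \<sigma>: "\<And>a b. f a (- b) - f (a - 1) (- b) = (if \<sigma> a \<le> b then 1 else 0)" by metis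
  have eq: "\<tau> b = a \<longleftrightarrow> - \<sigma> a = b" for a b
  proof -
    have "- (- b - 1) = b + 1" by simp
    then have "(if \<tau> b \<le> a then 1 else 0) - (if \<tau> b \<le> a - 1 then 1 else 0) =
        (if \<sigma> a \<le> - b then 1 else 0) - (if \<sigma> a \<le> - b - 1 then 1 else (0 :: int))"
      unfolding \<tau>[symmetric] \<sigma>[symmetric] by (simp add: add.commute)
    then show ?thesis by (auto split: if_splits)
  qed
  have "- \<sigma> (\<tau> b) = b" "\<tau> (- \<sigma> a) = a" for a b using eq by blast+
  then have "bij \<tau>" by (intro o_bij[of "\<lambda>a. - \<sigma> a"]) (auto simp: fun_eq_iff)
  then show ?thesis using \<tau> by blast
qed

lemma twist_twist: "twist u v (twist u v D a b) a' b' = twist u v D (a + a') (b + b')"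
  by (simp add: twist_def fun_eq_iff algebra_simps)

lemma twist_commute: "twist u v D a b = twist v u D b a"
  by (simp add: twist_def fun_eq_iff algebra_simps)

lemma deg_twist:
  assumes "is_graph G" "u \<in> verts G" "v \<in> verts G"
  shows "deg G (twist u v D a b) = deg G D + a + b"
  using deg_add_ind[OF assms(1,3), of "\<lambda>x. D x + a * ind u x" b] deg_add_ind[OF assms(1,2), of D a]
  by (simp add: twist_def)

lemma rank_twist_step:
  assumes "is_graph G" "u \<in> verts G"
  shows "rank G (twist u v D (a - 1) b) \<le> rank G (twist u v D a b)"
    "rank G (twist u v D a b) \<le> rank G (twist u v D (a - 1) b) + 1"
  using rank_add_vertex[OF assms, of "twist u v D a b" "twist u v D (a - 1) b"]
  by (auto simp: twist_def algebra_simps)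

lemma transmission_exists:
  assumes G: "is_graph G" and u: "u \<in> verts G" and v: "v \<in> verts G" and k: "1 \<le> k"
    and tors: "lin_equiv G (\<lambda>x. int k * ind u x) (\<lambda>x. int k * ind v x)"
    and sub: "submodular G u v D"
  shows "affine k (transmission_perm G u v D) \<and>
    (\<forall>a b. rank G (twist u v D a (- b)) + 1 = cnt (transmission_perm G u v D) (a + 1) b)"
proof -
  define f where "f a b = rank G (twist u v D a (- b))" for a b
  define \<Delta> where "\<Delta> a b = Delta G u v (twist u v D a (- b))" for a b
  have \<Delta>: "\<Delta> a b = f a b - f (a - 1) b - f a (b + 1) + f (a - 1) (b + 1)" for a b
    by (simp add: \<Delta>_def Delta_def twist_twist f_def algebra_simps)
  obtain \<tau> where \<tau>: "bij \<tau>" "\<And>a b. f a b - f a (b + 1) = (if \<tau> b \<le> a then 1 else 0)"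
  proof -
    have "\<exists>\<tau>. bij \<tau> \<and> (\<forall>a b. f a b - f a (b + 1) = (if \<tau> b \<le> a then 1 else 0))"
    proof (rule submodular_permutation)
      show "f (a - 1) b \<le> f a b \<and> f a b \<le> f (a - 1) b + 1" for a b
        unfolding f_def using rank_twist_step[OF G u] by blast
      show "f a (b + 1) \<le> f a b \<and> f a b \<le> f a (b + 1) + 1" for a b
        unfolding f_def twist_commute[of u v] using rank_twist_step[OF G v, of u D "- b" a] by simp
      show "f a b = - 1" if "a - b < - deg G D" for a b
        unfolding f_def using that by (intro rank_neg_deg[OF G]) (simp add: deg_twist[OF G u v])
      show "f a b = a - b + (deg G D - genus G)" if "2 * genus G - 1 - deg G D \<le> a - b" for a b
        unfolding f_def using that
        by (subst rank_large_deg[OF G]) (simp_all add: deg_twist[OF G u v])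
      show "0 \<le> f a b - f (a - 1) b - f a (b + 1) + f (a - 1) (b + 1)" for a b
        using sub unfolding submodular_def \<Delta>[symmetric] \<Delta>_def by blast
    qed
    then show thesis using that by blast
  qed
  have \<Delta>\<tau>: "\<Delta> a b = (if \<tau> b = a then 1 else 0)" for a b
    unfolding \<Delta> using \<tau>(2)[of a b] \<tau>(2)[of "a - 1" b] by (auto split: if_splits)
  have tp: "transmission_perm G u v D = \<tau>"
    unfolding transmission_perm_def \<Delta>_def[symmetric] \<Delta>\<tau>
  proof (rule the_equality)
    fix \<sigma> assume \<sigma>: "bij \<sigma> \<and> (\<forall>a b. (if \<sigma> b = a then 1 else 0) = (if \<tau> b = a then 1 else (0 :: int)))"
    show "\<sigma> = \<tau>"
    proof
      fix b show "\<sigma> b = \<tau> b" using \<sigma> by (metis zero_neq_one)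
    qed
  qed (use \<tau>(1) in simp)
  obtain c where c: "\<And>x. x \<in> verts G \<Longrightarrow> int k * ind v x = int k * ind u x + lap G c x"
    using tors unfolding lin_equiv_iff[OF G] by blast
  \<comment> \<open>Since \<open>k u\<close> and \<open>k v\<close> are equivalent, adding
    \<open>k u - k v\<close> does not change the rank.\<close>
  have per: "f (a + int k) (b + int k) = f a b" for a b
    unfolding f_def
    by (rule rank_equiv[OF G, where c = "\<lambda>x. - c x", symmetric, THEN sym])
      (use c lap_diff[of G "\<lambda>_. 0" c] in \<open>simp add: twist_def algebra_simps lap_def sum_negf\<close>)
  have "\<tau> (n + int k) = \<tau> n + int k" for n
  proof -
    have "\<Delta> (\<tau> n + int k) (n + int k) = \<Delta> (\<tau> n) n"
      unfolding \<Delta> using per[of "\<tau> n - 1" n] per[of "\<tau> n" "n + 1"] per[of "\<tau> n - 1" "n + 1"] per[of "\<tau> n" n]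
      by (simp add: algebra_simps)
    then show ?thesis unfolding \<Delta>\<tau> by (auto split: if_splits)
  qed
  then have aff: "affine k \<tau>" using \<tau>(1) k by (simp add: affine_def)
  \<comment> \<open>As functions of \<open>b\<close> both sides have the same differences, and both
    vanish for large \<open>b\<close>.\<close>
  have "f a b + 1 = cnt \<tau> (a + 1) b" for a b
  proof -
    have const: "f a b - cnt \<tau> (a + 1) b = f a b' - cnt \<tau> (a + 1) b'" if "b \<le> b'" for b'
      using that
    proof (induction b' rule: int_ge_induct)
      case (step i)
      then show ?case using \<tau>(2)[of a i] cnt_step[OF aff, of "a + 1" i] by (auto split: if_splits)
    qed simp
    define B where "B = Max {n. b \<le> n \<and> \<tau> n < a + 1}"
    have B: "n \<le> B" if "b \<le> n" "\<tau> n < a + 1" for n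
      unfolding B_def by (rule Max_ge[OF finite_cnt[OF aff]]) (use that in simp)
    define b' where "b' = max (max b (B + 1)) (deg G D + a + 1)"
    have "\<not> (b' \<le> n \<and> \<tau> n < a + 1)" for n using B[of n] by (auto simp: b'_def)
    then have "{n. b' \<le> n \<and> \<tau> n < a + 1} = {}" by blast
    then have "cnt \<tau> (a + 1) b' = 0" unfolding cnt_def by (simp only: card.empty of_nat_0)
    moreover have "f a b' = -1"
      unfolding f_def by (intro rank_neg_deg[OF G]) (auto simp: deg_twist[OF G u v] b'_def)
    moreover have "b \<le> b'" by (simp add: b'_def le_max_iff_disj)
    ultimately show ?thesis using const[of b'] by simp
  qed
  then show ?thesis using aff unfolding tp f_def by blast
qed

text \<open>Equivalent inversions with first entries in \<open>{0..<k}\<close> coincide, because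
  congruent numbers in that range are equal. Hence the representatives inject into the
  classes.\<close>

lemma card_invs_le_inv_k:
  assumes "inv_k k \<tau> \<le> enat g"
  shows "card (invs k \<tau>) \<le> g"
proof -
  let ?C = "inversions \<tau> // kequiv k \<tau>"
  have fin: "finite ?C" and card: "card ?C \<le> g"
    using assms by (auto simp: inv_k_def Let_def split: if_splits)
  have inj: "inj_on (\<lambda>p. kequiv k \<tau> `` {p}) (invs k \<tau>)"
  proof (rule inj_onI)
    fix p q assume p: "p \<in> invs k \<tau>" and q: "q \<in> invs k \<tau>" and eq: "kequiv k \<tau> `` {p} = kequiv k \<tau> `` {q}"
    have "q \<in> kequiv k \<tau> `` {q}" using q by (auto simp: kequiv_def invs_def inversions_def)
    then have pq: "(p, q) \<in> kequiv k \<tau>" using eq by blast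
    then have d: "fst p - fst q = snd p - snd q" "int k dvd fst p - fst q" by (auto simp: kequiv_def)
    have "0 \<le> fst p" "fst p < int k" "0 \<le> fst q" "fst q < int k" using p q by (auto simp: invs_def)
    then have "fst p = fst q" using d(2) by (metis mod_eq_dvd_iff mod_pos_pos_trivial)
    then show "p = q" using d(1) by (simp add: prod_eq_iff)
  qed
  have "card (invs k \<tau>) \<le> card ?C"
    by (rule card_inj_on_le[OF inj _ fin]) (auto simp: quotient_def invs_def inversions_def)
  then show ?thesis using card by simp
qed

text \<open>This extracts from general transmission what gluing uses: a permutation that computes
  the ranks of all twists and has at most \<open>g\<close> inversions modulo \<open>k\<close>. The
  existential form carries over to exchanged marks and relabelled vertices.\<close>

definition transmits :: "'v graph \<Rightarrow> 'v \<Rightarrow> 'v \<Rightarrow> nat \<Rightarrow> bool" where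
  "transmits G u v k \<longleftrightarrow> (\<forall>D. is_divisor G D \<longrightarrow> (\<exists>\<tau>. affine k \<tau> \<and>
     int (card (invs k \<tau>)) \<le> genus G \<and> (\<forall>a b. rank G (twist u v D a (- b)) + 1 = cnt \<tau> (a + 1) b)))"

lemma general_transmission_transmits:
  assumes "twice_marked G u v" "torsion_order G u v k" "general_transmission G u v k"
  shows "transmits G u v k"
  unfolding transmits_def
proof (intro allI impI)
  fix D assume D: "is_divisor G D"
  have G: "is_graph G" "u \<in> verts G" "v \<in> verts G" using assms(1) by (auto simp: twice_marked_def)
  have k: "1 \<le> k" "lin_equiv G (\<lambda>x. int k * ind u x) (\<lambda>x. int k * ind v x)"
    using assms(2) by (auto simp: torsion_order_def)
  have "submodular G u v D" "inv_k k (transmission_perm G u v D) \<le> enat (nat (genus G))"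
    using assms(3) D by (auto simp: general_transmission_def)
  then show "\<exists>\<tau>. affine k \<tau> \<and> int (card (invs k \<tau>)) \<le> genus G \<and>
      (\<forall>a b. rank G (twist u v D a (- b)) + 1 = cnt \<tau> (a + 1) b)"
    using transmission_exists[OF G k] card_invs_le_inv_k[of k "transmission_perm G u v D" "nat (genus G)"]
      genus_nonneg[OF G(1)]
    by (intro exI[of _ "transmission_perm G u v D"]) auto
qed

text \<open>Exchanging the marks turns \<open>\<tau>\<close> into
  \<open>\<sigma> m = - inv \<tau> (- m)\<close>: taking the inverse exchanges the roles of
  \<open>a\<close> and \<open>b\<close>, and the signs restore the direction of the two inequalities
  in \<open>cnt\<close>.\<close>

lemma transmits_sym:
  assumes "transmits G u v k" shows "transmits G v u k"
  unfolding transmits_def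
proof (intro allI impI)
  fix D assume "is_divisor G D"
  then obtain \<tau> where \<tau>: "affine k \<tau>" "int (card (invs k \<tau>)) \<le> genus G"
    "\<And>a b. rank G (twist u v D a (- b)) + 1 = cnt \<tau> (a + 1) b"
    using assms unfolding transmits_def by blast
  define \<sigma> where "\<sigma> m = - inv \<tau> (- m)" for m
  have bij: "bij \<tau>" and k: "1 \<le> k" using \<tau>(1) by (auto simp: affine_def)
  have \<tau>\<sigma>: "\<tau> (- \<sigma> m) = - m" for m using bij by (simp add: \<sigma>_def bij_is_surj surj_f_inv_f)
  have \<sigma>\<tau>: "\<sigma> (- \<tau> n) = - n" for n using bij by (simp add: \<sigma>_def bij_is_inj inv_f_f)
  have "\<sigma> (m + int k) = \<sigma> m + int k" for m
  proof -
    have "- m = \<tau> (- \<sigma> (m + int k) + int k)"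
      using \<tau>\<sigma>[of "m + int k"] affine_mult[OF \<tau>(1), of "- \<sigma> (m + int k)" 1] by simp
    then have "\<sigma> m = - (- \<sigma> (m + int k) + int k)" using \<sigma>\<tau>[of "- \<sigma> (m + int k) + int k"] by (metis minus_minus)
    then show ?thesis by simp
  qed
  moreover have "bij \<sigma>" by (rule o_bij[of "\<lambda>n. - \<tau> (- n)"]) (auto simp: fun_eq_iff \<tau>\<sigma> \<sigma>\<tau>)
  ultimately have \<sigma>: "affine k \<sigma>" using k by (simp add: affine_def)
  have rank: "rank G (twist v u D a (- b)) + 1 = cnt \<sigma> (a + 1) b" for a b
  proof -
    have "rank G (twist v u D a (- b)) + 1 = cnt \<tau> (- b + 1) (- a)"
      using \<tau>(3)[of "- b" "- a"] by (simp add: twist_commute[of v u])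
    also have "\<dots> = cnt \<sigma> (a + 1) b"
      unfolding cnt_def of_nat_eq_iff
      by (rule bij_betw_same_card[OF bij_betw_byWitness[where f = "\<lambda>n. - \<tau> n" and f' = "\<lambda>m. - \<sigma> m"]])
        (auto simp: \<tau>\<sigma> \<sigma>\<tau>)
    finally show ?thesis .
  qed
  \<comment> \<open>A pair \<open>(m, m')\<close> inverted by \<open>\<sigma>\<close> gives the pair
    \<open>(- \<sigma> m, - \<sigma> m')\<close> inverted by \<open>\<tau>\<close>; subtracting
    \<open>k j\<close> moves its first entry into \<open>{0..<k}\<close>.\<close>
  define N where "N = (\<lambda>(m, m'). let j = (- \<sigma> m) div int k in (- \<sigma> m - int k * j, - \<sigma> m' - int k * j))"
  have "inj_on N (invs k \<sigma>)"
  proof (rule inj_onI)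
    fix p q assume p: "p \<in> invs k \<sigma>" and q: "q \<in> invs k \<sigma>" and eq: "N p = N q"
    obtain a b a' b' where pq: "p = (a, b)" "q = (a', b')" by (metis surj_pair)
    define j where "j = (- \<sigma> a) div int k - (- \<sigma> a') div int k"
    have "- \<sigma> a = - \<sigma> a' + int k * j" "- \<sigma> b = - \<sigma> b' + int k * j"
      using eq unfolding pq N_def j_def by (auto simp: Let_def algebra_simps)
    then have "- a = - a' + int k * j" "- b = - b' + int k * j"
      using affine_mult[OF \<tau>(1)] by (metis \<tau>\<sigma>)+
    then have ab: "a' = a + int k * j" "b' = b + int k * j" by auto
    have "0 \<le> a" "a < int k" "0 \<le> a'" "a' < int k" using p q pq by (auto simp: invs_def)
    then have "a = a'" using ab(1) by (metis mod_mult_self2 mod_pos_pos_trivial)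
    then show "p = q" using ab pq by auto
  qed
  moreover have "N ` invs k \<sigma> \<subseteq> invs k \<tau>"
  proof (rule image_subsetI)
    fix p assume p: "p \<in> invs k \<sigma>"
    obtain a b where ab: "p = (a, b)" by force
    let ?x = "- \<sigma> a" and ?j = "(- \<sigma> a) div int k"
    have "a < b" "\<sigma> b < \<sigma> a" using p ab by (auto simp: invs_def)
    moreover have "?x - int k * ?j = ?x mod int k" by (simp add: minus_mult_div_eq_mod)
    moreover have "0 \<le> ?x mod int k" "?x mod int k < int k" using k by auto
    moreover have "\<tau> (- \<sigma> m - int k * ?j) = - m - int k * ?j" for m
      using affine_mult[OF \<tau>(1), of "- \<sigma> m" "- ?j"] \<tau>\<sigma>[of m] by simp
    moreover have "\<tau> (?x mod int k) = - a - int k * ?j"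
      using affine_mult[OF \<tau>(1), of ?x "- ?j"] \<tau>\<sigma>[of a] by (simp add: minus_mult_div_eq_mod)
    ultimately show "N p \<in> invs k \<tau>" unfolding ab N_def invs_def Let_def by simp
  qed
  ultimately have "card (invs k \<sigma>) \<le> card (invs k \<tau>)"
    by (rule card_inj_on_le) (rule finite_invs[OF \<tau>(1)])
  then show "\<exists>\<tau>. affine k \<tau> \<and> int (card (invs k \<tau>)) \<le> genus G \<and>
      (\<forall>a b. rank G (twist v u D a (- b)) + 1 = cnt \<tau> (a + 1) b)"
    using \<sigma> rank \<tau>(2) by (intro exI[of _ \<sigma>]) auto
qed

section \<open>Gluing at a vertex\<close>

definition glue2 :: "'v graph \<Rightarrow> 'v graph \<Rightarrow> 'v graph" where
  "glue2 A B = (verts A \<union> verts B, \<lambda>x y. mult A x y + mult B x y)"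

lemma verts_glue2: "verts (glue2 A B) = verts A \<union> verts B"
  by (simp add: glue2_def verts_def)

lemma mult_glue2: "mult (glue2 A B) x y = mult A x y + mult B x y"
  by (simp add: glue2_def mult_def)

lemma mult_outside:
  assumes "is_graph A" "x \<notin> verts A" shows "mult A x y = 0" "mult A y x = 0"
  using graphD(5)[OF assms(1), of x y] graphD(5)[OF assms(1), of y x] assms(2) by (meson neq0_conv)+

lemma sum_support:
  fixes f :: "'a \<Rightarrow> int"
  assumes "finite T" "S \<subseteq> T" "\<And>x. x \<in> T - S \<Longrightarrow> f x = 0"
  shows "sum f T = sum f S"
  using sum.mono_neutral_right[OF assms(1,2)] assms(3) by blast

locale vertex_gluing =
  fixes A B :: "'v graph" and w :: 'v
  assumes A: "is_graph A" and B: "is_graph B" and cut: "verts A \<inter> verts B = {w}"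
begin

abbreviation "G \<equiv> glue2 A B"

lemma w_in: "w \<in> verts A" "w \<in> verts B" using cut by auto

lemma fin: "finite (verts A)" "finite (verts B)" "finite (verts G)"
  using graphD(1)[OF A] graphD(1)[OF B] by (auto simp: verts_glue2)

lemma graph: "is_graph G"
proof -
  let ?R = "{(a, b). 0 < mult G a b}"
  have sub: "{(a, b). 0 < mult A a b}\<^sup>* \<subseteq> ?R\<^sup>*" "{(a, b). 0 < mult B a b}\<^sup>* \<subseteq> ?R\<^sup>*"
    by (intro rtrancl_mono; auto simp: mult_glue2)+
  have to: "(x, w) \<in> ?R\<^sup>*" and from_w: "(w, x) \<in> ?R\<^sup>*" if "x \<in> verts G" for x
    using that graphD(6)[OF A, of x w] graphD(6)[OF B, of x w] graphD(6)[OF A, of w x]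
      graphD(6)[OF B, of w x] w_in sub unfolding verts_glue2 by blast+
  have "(x, y) \<in> ?R\<^sup>*" if "x \<in> verts G" "y \<in> verts G" for x y
    using to[OF that(1)] from_w[OF that(2)] by (rule rtrancl_trans)
  moreover have "x \<in> verts G \<and> y \<in> verts G" if "0 < mult G x y" for x y
    using that graphD(5)[OF A, of x y] graphD(5)[OF B, of x y] by (auto simp: mult_glue2 verts_glue2)
  ultimately show ?thesis
    unfolding is_graph_def using fin w_in graphD(3,4)[OF A] graphD(3,4)[OF B]
    by (auto simp: mult_glue2 verts_glue2)
qed

lemma genus: "genus G = genus A + genus B"
proof -
  have 1: "(\<Sum>x\<in>verts G. \<Sum>y\<in>verts G. int (mult H x y)) = (\<Sum>x\<in>verts H. \<Sum>y\<in>verts H. int (mult H x y))"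
    if H: "is_graph H" "verts H \<subseteq> verts G" for H
  proof -
    have "(\<Sum>y\<in>verts G. int (mult H x y)) = (\<Sum>y\<in>verts H. int (mult H x y))" for x
      by (rule sum_support[OF fin(3) H(2)]) (simp add: mult_outside[OF H(1)])
    then show ?thesis
      by simp (rule sum_support[OF fin(3) H(2)], simp add: mult_outside[OF H(1)])
  qed
  have "2 * int (num_edges G) = 2 * int (num_edges A) + 2 * int (num_edges B)"
    unfolding double_num_edges[OF graph, symmetric] double_num_edges[OF A, symmetric]
      double_num_edges[OF B, symmetric]
    using 1[OF A] 1[OF B] by (simp add: mult_glue2 sum.distrib) (simp add: verts_glue2)
  moreover have "card (verts A \<union> verts B) + card (verts A \<inter> verts B) = card (verts A) + card (verts B)"
    using card_Un_Int[OF fin(1,2)] by simp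
  ultimately show ?thesis by (simp add: genus_def verts_glue2 cut)
qed

lemma lap: "lap G c x = lap A c x + lap B c x"
proof -
  have "lap A c x = (\<Sum>y\<in>verts G. (c y - c x) * int (mult A y x))"
    unfolding lap_def using fin by (intro sum_support[symmetric]) (auto simp: verts_glue2 mult_outside[OF A])
  moreover have "lap B c x = (\<Sum>y\<in>verts G. (c y - c x) * int (mult B y x))"
    unfolding lap_def using fin by (intro sum_support[symmetric]) (auto simp: verts_glue2 mult_outside[OF B])
  ultimately show ?thesis
    by (simp add: lap_def[of G] mult_glue2 sum.distrib[symmetric] algebra_simps)
qed

lemma deg:
  assumes "is_divisor A D" "is_divisor B E"
  shows "deg G (\<lambda>x. D x + E x) = deg A D + deg B E"
proof -
  have "sum D (verts G) = sum D (verts A)" "sum E (verts G) = sum E (verts B)"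
    using fin assms by (auto intro!: sum_support simp: verts_glue2 is_divisor_def)
  then show ?thesis by (simp add: deg_def sum.distrib)
qed

text \<open>A firing script on the glued graph restricts to both sides, and the two Laplacians add
  up at \<open>w\<close>. Only the distribution of the chips at \<open>w\<close> between the sides
  is free, and \<open>m\<close> records it.\<close>

lemma linsys_split:
  assumes D: "is_divisor A DA" "is_divisor B DB" and L: "linsys_nonempty G (\<lambda>x. DA x + DB x)"
  shows "\<exists>m. linsys_nonempty A (\<lambda>x. DA x + m * ind w x) \<and> linsys_nonempty B (\<lambda>x. DB x - m * ind w x)"
proof -
  obtain c where c: "\<And>x. x \<in> verts G \<Longrightarrow> 0 \<le> DA x + DB x + (lap A c x + lap B c x)"
    using L unfolding linsys_iff[OF graph] lap by blast
  have outA: "DA x + lap A c x = 0" if "x \<notin> verts A" for x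
    using that D mult_outside[OF A that] by (simp add: lap_def is_divisor_def)
  have outB: "DB x + lap B c x = 0" if "x \<notin> verts B" for x
    using that D mult_outside[OF B that] by (simp add: lap_def is_divisor_def)
  \<comment> \<open>This choice leaves exactly 0 chips at \<open>w\<close> on the side of
    \<open>A\<close> and assigns the whole nonnegative amount at \<open>w\<close> to
    \<open>B\<close>.\<close>
  define m where "m = - (DA w + lap A c w)"
  have "0 \<le> DA x + m * ind w x + lap A c x" if x: "x \<in> verts A" for x
  proof (cases "x = w")
    case False
    then have "x \<notin> verts B" using x cut by blast
    then show ?thesis using c[of x] outB[of x] x False by (simp add: verts_glue2 ind_def)
  qed (simp add: ind_def m_def)
  moreover have "0 \<le> DB x - m * ind w x + lap B c x" if x: "x \<in> verts B" for x
  proof (cases "x = w")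
    case False
    then have "x \<notin> verts A" using x cut by blast
    then show ?thesis using c[of x] outA[of x] x False by (simp add: verts_glue2 ind_def)
  next
    case True
    then show ?thesis using c[of w] x by (simp add: verts_glue2 ind_def m_def)
  qed
  ultimately show ?thesis unfolding linsys_iff[OF A] linsys_iff[OF B] by blast
qed

text \<open>Divisors \<open>EA\<close> and \<open>EB\<close> of degree one above the two ranks
  obstruct the two sides. If \<open>EA + EB\<close> did not obstruct the gluing,
  \<open>linsys_split\<close> would shift some \<open>m\<close> chips at \<open>w\<close>;
  \<open>m \<le> l\<close> contradicts \<open>EA\<close> and \<open>m \<ge> l + 1\<close>
  contradicts \<open>EB\<close>.\<close>

lemma rank_le:
  assumes D: "is_divisor A DA" "is_divisor B DB"
  shows "rank G (\<lambda>x. DA x + DB x) + 1 \<le>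
    (rank A (\<lambda>x. DA x + l * ind w x) + 1) + (rank B (\<lambda>x. DB x - (l + 1) * ind w x) + 1)"
proof -
  define p where "p = nat (rank A (\<lambda>x. DA x + l * ind w x) + 1)"
  define q where "q = nat (rank B (\<lambda>x. DB x - (l + 1) * ind w x) + 1)"
  have p: "int p = rank A (\<lambda>x. DA x + l * ind w x) + 1"
    and q: "int q = rank B (\<lambda>x. DB x - (l + 1) * ind w x) + 1"
    using rank_ge_minus1[of A "\<lambda>x. DA x + l * ind w x"]
      rank_ge_minus1[of B "\<lambda>x. DB x - (l + 1) * ind w x"] by (simp_all add: p_def q_def)
  have "\<not> int p \<le> rank A (\<lambda>x. DA x + l * ind w x)" using p by simp
  then obtain EA where EA: "is_divisor A EA" "effective A EA" "deg A EA = int p"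
    "\<not> linsys_nonempty A (\<lambda>x. DA x + l * ind w x - EA x)" unfolding rank_ge_iff[OF A] by blast
  have "\<not> int q \<le> rank B (\<lambda>x. DB x - (l + 1) * ind w x)" using q by simp
  then obtain EB where EB: "is_divisor B EB" "effective B EB" "deg B EB = int q"
    "\<not> linsys_nonempty B (\<lambda>x. DB x - (l + 1) * ind w x - EB x)" unfolding rank_ge_iff[OF B] by blast
  let ?E = "\<lambda>x. EA x + EB x"
  have "is_divisor G ?E" using EA(1) EB(1) by (auto simp: is_divisor_def verts_glue2)
  moreover have "effective G ?E"
    using EA(1,2) EB(1,2) by (auto simp: effective_def is_divisor_def verts_glue2) (metis add_nonneg_nonneg order_refl)+
  moreover have "deg G ?E = int (p + q)" using deg[OF EA(1) EB(1)] EA(3) EB(3) by simp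
  moreover have "\<not> linsys_nonempty G (\<lambda>x. DA x + DB x - ?E x)"
  proof
    assume "linsys_nonempty G (\<lambda>x. DA x + DB x - ?E x)"
    moreover have "(\<lambda>x. DA x + DB x - ?E x) = (\<lambda>x. (DA x - EA x) + (DB x - EB x))" by (simp add: fun_eq_iff)
    moreover have "is_divisor A (\<lambda>x. DA x - EA x)" "is_divisor B (\<lambda>x. DB x - EB x)"
      using D EA(1) EB(1) by (auto simp: is_divisor_def)
    ultimately obtain m where m: "linsys_nonempty A (\<lambda>x. DA x - EA x + m * ind w x)"
      "linsys_nonempty B (\<lambda>x. DB x - EB x - m * ind w x)"
      using linsys_split[of "\<lambda>x. DA x - EA x" "\<lambda>x. DB x - EB x"] by auto
    show False
    proof (cases "m \<le> l")
      case True
      then have "linsys_nonempty A (\<lambda>x. DA x + l * ind w x - EA x)"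
        by (intro linsys_mono[OF A m(1)]) (simp add: ind_def)
      then show False using EA(4) by blast
    next
      case False
      then have "linsys_nonempty B (\<lambda>x. DB x - (l + 1) * ind w x - EB x)"
        by (intro linsys_mono[OF B m(2)]) (simp add: ind_def)
      then show False using EB(4) by blast
    qed
  qed
  ultimately have "\<not> int (p + q) \<le> rank G (\<lambda>x. DA x + DB x)" unfolding rank_ge_iff[OF graph] by blast
  then show ?thesis using p q by simp
qed

lemma divisor_split:
  assumes "is_divisor G D"
  obtains DA DB where "is_divisor A DA" "is_divisor B DB" "D = (\<lambda>x. DA x + DB x)"
proof
  show "is_divisor A (\<lambda>x. if x \<in> verts A then D x else 0)" by (simp add: is_divisor_def)
  show "is_divisor B (\<lambda>x. if x \<in> verts A then 0 else D x)"
    using assms by (simp add: is_divisor_def verts_glue2)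
qed auto

end

text \<open>An upper bound \<open>F\<close> is demanded rather than the rank function itself, since
  \<open>rank_le\<close> controls the ranks of a gluing only from above.\<close>

definition weight_bounded :: "'v graph \<Rightarrow> 'v \<Rightarrow> bool" where
  "weight_bounded G v \<longleftrightarrow> (\<forall>D. is_divisor G D \<longrightarrow> (\<exists>F. profile (deg G D - genus G + 1) F \<and>
     weight (deg G D - genus G + 1) F \<le> genus G \<and> (\<forall>b. rank G (\<lambda>x. D x - b * ind v x) + 1 \<le> F b)))"

lemma cnt_tail:
  assumes Q: "is_graph Q" "u \<in> verts Q" "v \<in> verts Q"
    and \<tau>: "\<And>a b. rank Q (twist u v D a (- b)) + 1 = cnt \<tau> (a + 1) b"
    and ab: "b \<le> a - (2 * genus Q - deg Q D)"
  shows "cnt \<tau> a b = a - (genus Q - deg Q D) - b"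
proof -
  have d: "deg Q (twist u v D (a - 1) (- b)) = deg Q D + a - 1 - b" by (simp add: deg_twist[OF Q])
  then have "rank Q (twist u v D (a - 1) (- b)) = deg Q D + a - 1 - b - genus Q"
    using rank_large_deg[OF Q(1), of "twist u v D (a - 1) (- b)"] ab by simp
  then show ?thesis using \<tau>[of "a - 1" b] by simp
qed

lemma (in vertex_gluing) weight_bounded_glue:
  assumes v: "v \<in> verts B" and wA: "weight_bounded A w" and tr: "transmits B w v k"
    and k: "genus A + genus B < int k"
  shows "weight_bounded G v"
  unfolding weight_bounded_def
proof (intro allI impI)
  fix D assume "is_divisor G D"
  then obtain DA DB where D: "is_divisor A DA" "is_divisor B DB" "D = (\<lambda>x. DA x + DB x)"
    by (rule divisor_split)
  let ?c = "deg A DA - genus A + 1" and ?t = "genus B - deg B DB"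
  have degD: "deg G D - genus G + 1 = ?c - ?t" unfolding D(3) deg[OF D(1,2)] genus by simp
  obtain F where F: "profile ?c F" "weight ?c F \<le> genus A"
    "\<And>b. rank A (\<lambda>x. DA x - b * ind w x) + 1 \<le> F b"
    using wA D(1) unfolding weight_bounded_def by blast
  obtain \<tau> where \<tau>: "affine k \<tau>" "int (card (invs k \<tau>)) \<le> genus B"
    "\<And>a b. rank B (twist w v DB a (- b)) + 1 = cnt \<tau> (a + 1) b"
    using tr D(2) unfolding transmits_def by blast
  have "weight ?c F + int (card (invs k \<tau>)) < int k" using F(2) \<tau>(2) k by linarith
  then obtain F' where F': "profile (?c - ?t) F'" "weight (?c - ?t) F' \<le> weight ?c F + int (card (invs k \<tau>))"
    "\<And>b. \<exists>a. F a + cnt \<tau> a b \<le> F' b"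
    using affine_action[OF \<tau>(1) F(1) _ cnt_tail[OF B w_in(2) v \<tau>(3)]] by blast
  have "rank G (\<lambda>x. D x - b * ind v x) + 1 \<le> F' b" for b
  proof -
    obtain a where a: "F a + cnt \<tau> a b \<le> F' b" using F'(3) by blast
    have "is_divisor B (\<lambda>x. DB x - b * ind v x)" using D(2) v by (auto simp: is_divisor_def ind_def)
    \<comment> \<open>With \<open>l = - a\<close> the side of \<open>B\<close> carries
      \<open>a - 1\<close> extra chips at \<open>w\<close>, so its term is
      \<open>cnt \<tau> a b\<close> without a shift in \<open>a\<close>.\<close>
    from rank_le[OF D(1) this, of "- a"]
    have "rank G (\<lambda>x. D x - b * ind v x) + 1 \<le> (rank A (\<lambda>x. DA x - a * ind w x) + 1) +
        (rank B (twist w v DB (a - 1) (- b)) + 1)"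
      unfolding D(3) twist_def by (simp add: algebra_simps)
    also have "\<dots> \<le> F a + cnt \<tau> a b" using F(3)[of a] \<tau>(3)[of "a - 1" b] by simp
    finally show ?thesis using a by simp
  qed
  moreover have "weight (?c - ?t) F' \<le> genus G" using F'(2) F(2) \<tau>(2) unfolding genus by linarith
  ultimately show "\<exists>F. profile (deg G D - genus G + 1) F \<and> weight (deg G D - genus G + 1) F \<le> genus G \<and>
      (\<forall>b. rank G (\<lambda>x. D x - b * ind v x) + 1 \<le> F b)"
    unfolding degD using F'(1) by blast
qed

text \<open>The one-vertex graph is neutral for gluing at its vertex, so that statements on two
  glued graphs specialize to a single one.\<close>

definition point :: "'v \<Rightarrow> 'v graph" where "point w = ({w}, \<lambda>_ _. 0)"

lemma point_graph: "is_graph (point w)" "verts (point w) = {w}" "genus (point w) = 0"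
  by (auto simp: point_def is_graph_def verts_def mult_def genus_def num_edges_def)

lemma glue2_point: "w \<in> verts G \<Longrightarrow> glue2 (point w) G = G" "w \<in> verts G \<Longrightarrow> glue2 G (point w) = G"
  by (auto simp: glue2_def point_def verts_def mult_def prod_eq_iff fun_eq_iff)

lemma weight_bounded_genus0:
  assumes G: "is_graph G" "v \<in> verts G" "genus G = 0" shows "weight_bounded G v"
  unfolding weight_bounded_def
proof (intro allI impI)
  fix D
  let ?c = "deg G D - genus G + 1"
  have "rank G (\<lambda>x. D x - b * ind v x) + 1 \<le> max 0 (?c - b)" for b
  proof -
    have "deg G (\<lambda>x. D x - b * ind v x) = deg G D - b" using deg_add_ind[OF G(1,2), of D "- b"] by simp
    then show ?thesis
      using rank_large_deg[OF G(1), of "\<lambda>x. D x - b * ind v x"] rank_neg_deg[OF G(1), of "\<lambda>x. D x - b * ind v x"] G(3)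
      by (cases "b \<le> deg G D") auto
  qed
  then show "\<exists>F. profile ?c F \<and> weight ?c F \<le> genus G \<and> (\<forall>b. rank G (\<lambda>x. D x - b * ind v x) + 1 \<le> F b)"
    using profile_point[of ?c] weight_point[of ?c] G(3) by (intro exI[of _ "\<lambda>b. max 0 (?c - b)"]) simp
qed

lemma weight_bounded_transmits:
  assumes Q: "is_graph Q" "u \<in> verts Q" "v \<in> verts Q" and "transmits Q u v k" "genus Q < int k"
  shows "weight_bounded Q v"
proof -
  interpret vertex_gluing "point u" Q u
    using Q by unfold_locales (auto simp: point_graph)
  have "weight_bounded (glue2 (point u) Q) v"
    using assms by (intro weight_bounded_glue) (auto intro: weight_bounded_genus0 simp: point_graph)
  then show ?thesis by (simp add: glue2_point[OF Q(2)])
qed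

text \<open>Each gap of \<open>FA\<close> and \<open>FB\<close> along the antidiagonal pairs off with a diagonal of an \<open>h\<close> by \<open>y\<close>
  rectangle.\<close>

lemma rectangle_le_weights:
  assumes FA: "profile cA FA" and FB: "profile cB FB" and h: "\<And>a. h \<le> FA a + FB (1 - a)"
    and pos: "0 \<le> h" "0 \<le> y" and y: "y = h - (cA + cB - 1)"
  shows "h * y \<le> weight cA FA + weight cB FB"
proof -
  let ?R = "{0..<h} \<times> {0..<y}" and ?Z = "{- y..h}"
  have diag: "int (card {p \<in> ?R. fst p - snd p = z}) \<le> gap cA FA (cA - z) + gap cB FB (1 - cA + z)" for z
  proof -
    have "card {p \<in> ?R. fst p - snd p = z} \<le> card {max 0 z..<min h (y + z)}"
    proof (rule card_inj_on_le[where f = fst])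
      show "inj_on fst {p \<in> ?R. fst p - snd p = z}" by (rule inj_onI) (auto simp: prod_eq_iff)
    qed auto
    also have "int \<dots> \<le> max 0 (min h (y + z) - max 0 z)" by simp
    also have "\<dots> \<le> gap cA FA (cA - z) + gap cB FB (1 - cA + z)"
    proof (rule max.boundedI)
      show "0 \<le> gap cA FA (cA - z) + gap cB FB (1 - cA + z)"
        using gap_nonneg[OF FA] gap_nonneg[OF FB] by (simp add: add_nonneg_nonneg)
      have "1 - (cA - z) = 1 - cA + z" by simp
      then have "h \<le> FA (cA - z) + FB (1 - cA + z)" using h[of "cA - z"] by metis
      \<comment> \<open>By the relation for \<open>y\<close>, the terms subtracted in the two gaps
        are \<open>max 0 z\<close> and \<open>max 0 (h - y - z)\<close>, and
        \<open>h - max 0 (h - y - z) = min h (y + z)\<close>.\<close>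
      then show "min h (y + z) - max 0 z \<le> gap cA FA (cA - z) + gap cB FB (1 - cA + z)"
        unfolding gap_def using y by linarith
    qed
    finally show ?thesis by simp
  qed
  have "h * y = int (card ?R)" using pos by (simp add: card_cartesian_product)
  also have "card ?R = (\<Sum>z\<in>?Z. card {p \<in> ?R. fst p - snd p = z})"
  proof -
    have "(\<lambda>p. fst p - snd p) ` ?R \<subseteq> ?Z" by auto
    then show ?thesis using sum.group[of ?R ?Z "\<lambda>p. fst p - snd p" "\<lambda>_. 1::nat"] by simp
  qed
  also have "int \<dots> \<le> (\<Sum>z\<in>?Z. gap cA FA (cA - z) + gap cB FB (1 - cA + z))"
    using diag by (simp add: sum_mono)
  also have "\<dots> = sum (gap cA FA) ((\<lambda>z. cA - z) ` ?Z) + sum (gap cB FB) ((\<lambda>z. 1 - cA + z) ` ?Z)"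
  proof -
    have "inj_on (\<lambda>z. cA - z) ?Z" "inj_on (\<lambda>z. 1 - cA + z) ?Z" by (auto intro: inj_onI)
    then show ?thesis unfolding sum.distrib by (simp only: sum.reindex o_def)
  qed
  also have "\<dots> \<le> weight cA FA + weight cB FB"
    using sum_le_weight[OF FA] sum_le_weight[OF FB] by (simp add: add_mono)
  finally show ?thesis .
qed

text \<open>The rectangle has sides \<open>r + 1\<close> and \<open>g - d + r\<close>;
  \<open>rank_le\<close> with \<open>l = - a\<close> supplies the inequality pairing position
  \<open>a\<close> on \<open>A\<close> with \<open>1 - a\<close> on \<open>B\<close>. The two
  weights add up to at most the genus of the gluing. If the second side is negative, the claim
  follows from the sign alone.\<close>

lemma (in vertex_gluing) bn_general_glue:
  assumes "weight_bounded A w" "weight_bounded B w"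
  shows "bn_general G"
  unfolding bn_general_def
proof (intro allI impI)
  fix D :: "'v \<Rightarrow> int" and r :: int assume "is_divisor G D" and r: "0 \<le> r \<and> r \<le> rank G D"
  then obtain DA DB where D: "is_divisor A DA" "is_divisor B DB" "D = (\<lambda>x. DA x + DB x)"
    using divisor_split by blast
  let ?cA = "deg A DA - genus A + 1" and ?cB = "deg B DB - genus B + 1" and ?y = "genus G - deg G D + r"
  obtain FA where FA: "profile ?cA FA" "weight ?cA FA \<le> genus A"
    "\<And>b. rank A (\<lambda>x. DA x - b * ind w x) + 1 \<le> FA b"
    using assms(1) D(1) unfolding weight_bounded_def by blast
  obtain FB where FB: "profile ?cB FB" "weight ?cB FB \<le> genus B"
    "\<And>b. rank B (\<lambda>x. DB x - b * ind w x) + 1 \<le> FB b"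
    using assms(2) D(2) unfolding weight_bounded_def by blast
  have "(r + 1) * ?y \<le> genus G"
  proof (cases "0 \<le> ?y")
    case True
    have "r + 1 \<le> FA a + FB (1 - a)" for a
      using rank_le[OF D(1,2), of "- a"] FA(3)[of a] FB(3)[of "1 - a"] r
      unfolding D(3) by (simp add: algebra_simps)
    then have "(r + 1) * ?y \<le> weight ?cA FA + weight ?cB FB"
      using r True by (intro rectangle_le_weights[OF FA(1) FB(1)]) (auto simp: D(3) deg[OF D(1,2)] genus)
    then show ?thesis using FA(2) FB(2) genus by linarith
  next
    case False
    then have "(r + 1) * ?y \<le> 0" using r by (intro mult_nonneg_nonpos) auto
    then show ?thesis using genus_nonneg[OF graph] by linarith
  qed
  then show "0 \<le> genus G - (r + 1) * ?y" by simp
qed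

lemma weight_bounded_bn_general:
  assumes G: "is_graph G" "v \<in> verts G" and "weight_bounded G v"
  shows "bn_general G"
proof -
  interpret vertex_gluing G "point v" v
    using G by unfold_locales (auto simp: point_graph)
  have "weight_bounded (point v) v" by (intro weight_bounded_genus0) (simp_all add: point_graph)
  then show ?thesis using bn_general_glue assms(3) by (simp add: glue2_point[OF G(2)])
qed

text \<open>Double counting of the cells \<open>(i, b)\<close> between Riemann's bound and the rank
  function: row \<open>i\<close> has \<open>\<lambda>\<^sub>i\<close> cells and column
  \<open>b\<close> has at most \<open>gap c F b\<close>.\<close>

lemma weight_bounded_once_marked:
  assumes G: "is_graph G" and v: "v \<in> verts G" and wb: "weight_bounded G v"
  shows "once_marked_bn_general G v"
  unfolding once_marked_bn_general_def
proof (intro allI impI)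
  fix D assume "is_divisor G D"
  define c where "c = deg G D - genus G + 1"
  define X where "X b = rank G (\<lambda>x. D x - b * ind v x) + 1" for b
  obtain F where F: "profile c F" "weight c F \<le> genus G" "\<And>b. X b \<le> F b"
    using wb \<open>is_divisor G D\<close> unfolding weight_bounded_def c_def X_def by blast
  have Xge: "c - b \<le> X b" for b
    using rank_ge_deg[OF G, of "\<lambda>x. D x - b * ind v x"] deg_add_ind[OF G v, of D "- b"]
    by (simp add: X_def c_def)
  define R where "R i b \<longleftrightarrow> max 0 (c - b) \<le> int i \<and> int i < X b" for i b
  have lam: "finite {b. R i b} \<and> wlambda G D v i = int (card {b. R i b})" for i
  proof -
    \<comment> \<open>\<open>X\<close> is nonincreasing, so its argument is negated to obtain a
      nondecreasing step function; the jump is the value of \<open>s_seq\<close>.\<close>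
    define p where "p a = (if int i < X (- a) then 1 else 0 :: int)" for a
    obtain hi where hi: "\<forall>b\<ge>hi. F b = 0" using F(1) by (auto simp: profile_def)
    have "\<exists>t. \<forall>a. p a = (if t \<le> a then 1 else 0)"
    proof (rule jump_position)
      show "p (a - 1) \<le> p a" for a
        using rank_add_vertex(1)[OF G v, of "\<lambda>x. D x - - a * ind v x" "\<lambda>x. D x - (- (a - 1)) * ind v x"]
        by (auto simp: p_def X_def algebra_simps)
      show "0 \<le> p a \<and> p a \<le> 1" for a by (simp add: p_def)
      show "p (- hi) = 0" using F(3)[of hi] hi by (simp add: p_def)
      show "p (int i + 1 - c) = 1" using Xge[of "c - int i - 1"] by (simp add: p_def algebra_simps)
    qed
    then obtain t where t: "\<And>a. int i < X (- a) \<longleftrightarrow> t \<le> a" unfolding p_def by (metis zero_neq_one)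
    have "s_seq G D v i = t"
      unfolding s_seq_def
    proof (rule Least_equality)
      show "int i \<le> rank G (\<lambda>x. D x + t * ind v x)" using t[of t] by (simp add: X_def)
      show "t \<le> l" if "int i \<le> rank G (\<lambda>x. D x + l * ind v x)" for l using t[of l] that by (simp add: X_def)
    qed
    then have "wlambda G D v i = int i + 1 - t - c" by (simp add: wlambda_def c_def)
    moreover have "t \<le> int i + 1 - c" using t[of "int i + 1 - c"] Xge[of "c - int i - 1"] by (simp add: algebra_simps)
    \<comment> \<open>Row \<open>i\<close> is an interval of length \<open>i + 1 - t - c\<close>,
      the value of \<open>wlambda\<close>.\<close>
    moreover have "R i b \<longleftrightarrow> b \<in> {c - int i..- t}" for b
      unfolding R_def using t[of "- b"] by auto
    then have "{b. R i b} = {c - int i..- t}" by blast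
    ultimately show ?thesis by (simp only:) simp
  qed
  let ?S = "{b. gap c F b \<noteq> 0}" and ?I = "{i. wlambda G D v i \<noteq> 0}"
  have S: "finite ?S" by (rule finite_gap[OF F(1)])
  have RS: "b \<in> ?S" if "R i b" for i b using that F(3)[of b] by (auto simp: R_def gap_def)
  have Rcol: "{i. R i b} = {nat (max 0 (c - b))..<nat (X b)}" for b by (auto simp: R_def)
  have "?I \<subseteq> (\<Union>b\<in>?S. {i. R i b})"
  proof
    fix i assume "i \<in> ?I"
    then have "{b. R i b} \<noteq> {}" using lam[of i] by (metis (mono_tags) card.empty mem_Collect_eq of_nat_0)
    then show "i \<in> (\<Union>b\<in>?S. {i. R i b})" using RS by blast
  qed
  moreover have "finite (\<Union>b\<in>?S. {i. R i b})" using S by (auto simp: Rcol)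
  ultimately have I: "finite ?I" using finite_subset by blast
  have "(\<Sum>i\<in>?I. wlambda G D v i) = (\<Sum>i\<in>?I. \<Sum>b\<in>?S. if R i b then 1 else 0)"
  proof (rule sum.cong[OF refl])
    fix i
    have "{b. R i b} = ?S \<inter> {b. R i b}" using RS by blast
    then show "wlambda G D v i = (\<Sum>b\<in>?S. if R i b then 1 else 0)"
      using lam[of i] S by (simp add: sum.If_cases)
  qed
  also have "\<dots> = (\<Sum>b\<in>?S. \<Sum>i\<in>?I. if R i b then 1 else 0)" by (rule sum.swap)
  also have "\<dots> \<le> (\<Sum>b\<in>?S. gap c F b)"
  proof (rule sum_mono)
    fix b
    have "(\<Sum>i\<in>?I. if R i b then 1 else 0) = int (card (?I \<inter> {i. R i b}))" using I by (simp add: sum.If_cases)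
    also have "\<dots> \<le> int (card {i. R i b})" unfolding of_nat_le_iff by (intro card_mono) (simp_all add: Rcol)
    also have "\<dots> \<le> gap c F b"
      using F(3)[of b] gap_nonneg[OF F(1), of b] by (auto simp: Rcol gap_def)
    finally show "(\<Sum>i\<in>?I. if R i b then 1 else 0) \<le> gap c F b" .
  qed
  also have "\<dots> \<le> genus G" using F(2) by (simp add: weight_def)
  finally show "finite ?I \<and> (\<Sum>i\<in>?I. wlambda G D v i) \<le> genus G" using I by blast
qed

section \<open>Iterated gluing\<close>

definition map_graph :: "('v \<Rightarrow> 'w) \<Rightarrow> 'v graph \<Rightarrow> 'w graph" where
  "map_graph f G = (f ` verts G,
     \<lambda>a b. \<Sum>x\<in>verts G. \<Sum>y\<in>verts G. if f x = a \<and> f y = b then mult G x y else 0)"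

locale graph_embedding =
  fixes f :: "'v \<Rightarrow> 'w" and G :: "'v graph"
  assumes G: "is_graph G" and inj: "inj_on f (verts G)"
begin

abbreviation "H \<equiv> map_graph f G"

lemma verts_map: "verts H = f ` verts G" by (simp add: map_graph_def verts_def)

lemma fin: "finite (verts G)" by (rule graphD(1)[OF G])

lemma mult_map:
  assumes "x \<in> verts G" "y \<in> verts G" shows "mult H (f x) (f y) = mult G x y"
proof -
  have "mult H (f x) (f y) = (\<Sum>x'\<in>verts G. if x' = x then (\<Sum>y'\<in>verts G. if y' = y then mult G x' y' else 0) else 0)"
    unfolding map_graph_def mult_def[of "(_, _)"] snd_conv
    using assms inj by (intro sum.cong refl) (auto simp: inj_on_eq_iff)
  then show ?thesis using assms fin by simp
qed

lemma mult_map_outside: "0 < mult H a b \<Longrightarrow> a \<in> verts H \<and> b \<in> verts H"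
proof (rule ccontr)
  assume m: "0 < mult H a b" and "\<not> (a \<in> verts H \<and> b \<in> verts H)"
  then have "(if f x = a \<and> f y = b then mult G x y else 0) = 0" if "x \<in> verts G" "y \<in> verts G" for x y
    using that by (auto simp: verts_map)
  then have "mult H a b = 0"
    unfolding map_graph_def mult_def[of "(_, _)"] snd_conv by (intro sum.neutral ballI)
  then show False using m by simp
qed

lemma mult_map_pos: "0 < mult H a b \<longleftrightarrow> (\<exists>x y. a = f x \<and> b = f y \<and> 0 < mult G x y)"
proof
  assume m: "0 < mult H a b"
  then obtain x y where "a = f x" "b = f y" "x \<in> verts G" "y \<in> verts G"
    using mult_map_outside verts_map by blast
  then show "\<exists>x y. a = f x \<and> b = f y \<and> 0 < mult G x y" using m mult_map by auto
qed (use graphD(5)[OF G] mult_map in force)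

lemma graph: "is_graph H"
proof -
  have sym: "mult H a b = mult H b a" and loop: "mult H a a = 0" for a b
  proof -
    show "mult H a b = mult H b a"
    proof (cases "a \<in> verts H \<and> b \<in> verts H")
      case True
      then show ?thesis using mult_map graphD(3)[OF G] by (auto simp: verts_map)
    next
      case False
      then show ?thesis using mult_map_outside by (metis neq0_conv)
    qed
    show "mult H a a = 0"
    proof (cases "a \<in> verts H")
      case True
      then show ?thesis using mult_map graphD(4)[OF G] by (auto simp: verts_map)
    next
      case False
      then show ?thesis using mult_map_outside by (metis neq0_conv)
    qed
  qed
  have "(f x, f y) \<in> {(a, b). 0 < mult H a b}\<^sup>*" if "x \<in> verts G" "y \<in> verts G" for x y
    using graphD(6)[OF G that]
  proof (induction rule: rtrancl_induct)
    case (step y z)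
    then have "(f y, f z) \<in> {(a, b). 0 < mult H a b}" using mult_map_pos by auto
    then show ?case using step.IH by (rule rtrancl_into_rtrancl[rotated])
  qed simp
  then have "\<forall>a\<in>verts H. \<forall>b\<in>verts H. (a, b) \<in> {(a, b). 0 < mult H a b}\<^sup>*" by (auto simp: verts_map)
  moreover have "finite (verts H)" "verts H \<noteq> {}" using fin graphD(2)[OF G] by (auto simp: verts_map)
  ultimately show ?thesis unfolding is_graph_def using sym loop mult_map_outside by blast
qed

lemma sum_map: "sum g (verts H) = (\<Sum>x\<in>verts G. g (f x))"
  by (simp add: verts_map sum.reindex[OF inj] o_def)

lemma genus: "genus H = genus G"
proof -
  have "2 * int (num_edges H) = 2 * int (num_edges G)"
    unfolding double_num_edges[OF graph, symmetric] double_num_edges[OF G, symmetric] sum_map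
    by (intro sum.cong refl) (simp add: mult_map)
  then show ?thesis by (simp add: genus_def verts_map card_image[OF inj])
qed

lemma lap: "x \<in> verts G \<Longrightarrow> lap H c (f x) = lap G (\<lambda>x. c (f x)) x"
  unfolding lap_def sum_map by (intro sum.cong refl) (simp add: mult_map)

lemma linsys: "linsys_nonempty H D \<longleftrightarrow> linsys_nonempty G (\<lambda>x. D (f x))"
proof
  assume "linsys_nonempty H D"
  then obtain c where "\<forall>a\<in>verts H. 0 \<le> D a + lap H c a" unfolding linsys_iff[OF graph] by blast
  then have "\<forall>x\<in>verts G. 0 \<le> D (f x) + lap G (\<lambda>x. c (f x)) x" using lap by (simp add: verts_map)
  then show "linsys_nonempty G (\<lambda>x. D (f x))" unfolding linsys_iff[OF G] by blast
next
  assume "linsys_nonempty G (\<lambda>x. D (f x))"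
  then obtain c where c: "\<forall>x\<in>verts G. 0 \<le> D (f x) + lap G c x" unfolding linsys_iff[OF G] by blast
  have "lap H (\<lambda>a. c (inv_into (verts G) f a)) (f x) = lap G c x" if "x \<in> verts G" for x
    unfolding lap[OF that] unfolding lap_def using that by (intro sum.cong refl) (simp add: inv_into_f_f[OF inj])
  then have "\<forall>a\<in>verts H. 0 \<le> D a + lap H (\<lambda>a. c (inv_into (verts G) f a)) a" using c by (simp add: verts_map)
  then show "linsys_nonempty H D" unfolding linsys_iff[OF graph] by blast
qed

lemma rank_ge: "int r \<le> rank H D \<longleftrightarrow> int r \<le> rank G (\<lambda>x. D (f x))"
proof
  assume r: "int r \<le> rank H D"
  show "int r \<le> rank G (\<lambda>x. D (f x))"
    unfolding rank_ge_iff[OF G]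
  proof (intro allI impI)
    fix E assume E: "is_divisor G E \<and> effective G E \<and> deg G E = int r"
    define E' where "E' a = (if a \<in> verts H then E (inv_into (verts G) f a) else 0)" for a
    have E'f: "E' (f x) = E x" if "x \<in> verts G" for x using that by (simp add: E'_def verts_map inv_into_f_f[OF inj])
    have "is_divisor H E'" by (simp add: is_divisor_def E'_def)
    moreover have "effective H E'" using E E'f by (auto simp: effective_def verts_map)
    moreover have "deg H E' = int r" using E E'f by (simp add: deg_def sum_map)
    ultimately have "linsys_nonempty H (\<lambda>a. D a - E' a)" using r unfolding rank_ge_iff[OF graph] by blast
    then have "linsys_nonempty G (\<lambda>x. D (f x) - E' (f x))" by (simp add: linsys)
    then show "linsys_nonempty G (\<lambda>x. D (f x) - E x)" by (rule linsys_mono[OF G]) (simp add: E'f)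
  qed
next
  assume r: "int r \<le> rank G (\<lambda>x. D (f x))"
  show "int r \<le> rank H D"
    unfolding rank_ge_iff[OF graph]
  proof (intro allI impI)
    fix E assume E: "is_divisor H E \<and> effective H E \<and> deg H E = int r"
    define E' where "E' x = (if x \<in> verts G then E (f x) else 0)" for x
    have "is_divisor G E'" by (simp add: is_divisor_def E'_def)
    moreover have "effective G E'" using E by (auto simp: effective_def verts_map E'_def)
    moreover have "deg G E' = int r" using E by (simp add: deg_def sum_map E'_def)
    ultimately have "linsys_nonempty G (\<lambda>x. D (f x) - E' x)" using r unfolding rank_ge_iff[OF G] by blast
    then have "linsys_nonempty G (\<lambda>x. D (f x) - E (f x))" by (rule linsys_mono[OF G]) (simp add: E'_def)
    then show "linsys_nonempty H (\<lambda>a. D a - E a)" by (simp add: linsys)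
  qed
qed

lemma rank: "rank H D = rank G (\<lambda>x. D (f x))"
  using rank_ge by (intro antisym rank_leI rank_ge_minus1) auto

lemma transmits:
  assumes "u \<in> verts G" "v \<in> verts G" "transmits G u v k"
  shows "transmits H (f u) (f v) k"
  unfolding transmits_def
proof (intro allI impI)
  fix D :: "'w \<Rightarrow> int"
  define D' where "D' x = (if x \<in> verts G then D (f x) else 0)" for x
  have "is_divisor G D'" by (simp add: is_divisor_def D'_def)
  moreover have "rank H (twist (f u) (f v) D a b) = rank G (twist u v D' a b)" for a b
    unfolding rank
    by (rule rank_cong[OF G]) (use inj assms in \<open>auto simp: twist_def D'_def ind_def inj_on_eq_iff\<close>)
  ultimately show "\<exists>\<tau>. affine k \<tau> \<and> int (card (invs k \<tau>)) \<le> genus H \<and>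
      (\<forall>a b. rank H (twist (f u) (f v) D a (- b)) + 1 = cnt \<tau> (a + 1) b)"
    using assms(3) unfolding transmits_def genus by simp
qed

end

lemma glue2_commute: "glue2 A B = glue2 B A"
  by (simp add: glue2_def Un_commute add.commute)

section \<open>The glued chain as a union of consecutive pieces\<close>

locale graph_chain =
  fixes Gs :: "('v graph \<times> 'v \<times> 'v) list" and n :: nat
  defines "n \<equiv> length Gs"
  assumes nonempty: "Gs \<noteq> []"
    and marked: "\<And>i. i < n \<Longrightarrow> twice_marked (tg (Gs ! i)) (tu (Gs ! i)) (tv (Gs ! i))"
begin

abbreviation "g i \<equiv> tg (Gs ! i)"
abbreviation "cls i x \<equiv> gl_class Gs (i, x)"
abbreviation "u i \<equiv> cls i (tu (Gs ! i))"
abbreviation "v i \<equiv> cls i (tv (Gs ! i))"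

definition piece :: "nat \<Rightarrow> (nat \<times> 'v) set graph" where
  "piece i = map_graph (cls i) (g i)"

text \<open>With half-open index ranges a segment splits at any inner index into two segments that
  share just the gluing vertex there.\<close>

definition segment :: "nat \<Rightarrow> nat \<Rightarrow> (nat \<times> 'v) set graph" where
  "segment a b = (\<Union>i\<in>{a..<b}. verts (piece i), \<lambda>x y. \<Sum>i\<in>{a..<b}. mult (piece i) x y)"

lemma markedD: "i < n \<Longrightarrow> is_graph (g i)" "i < n \<Longrightarrow> tu (Gs ! i) \<in> verts (g i)"
  "i < n \<Longrightarrow> tv (Gs ! i) \<in> verts (g i)"
  using marked by (auto simp: twice_marked_def)

lemma base_iff: "(i, x) \<in> gl_base Gs \<longleftrightarrow> i < n \<and> x \<in> verts (g i)"
  by (simp add: gl_base_def n_def)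

lemma cls_eq_iff:
  assumes "p \<in> gl_base Gs" "q \<in> gl_base Gs"
  shows "gl_class Gs p = gl_class Gs q \<longleftrightarrow> equivclp (gl_step Gs) p q"
proof
  assume "gl_class Gs p = gl_class Gs q"
  moreover have "q \<in> gl_class Gs q" using assms by (simp add: gl_class_def)
  ultimately have "q \<in> gl_class Gs p" by simp
  then show "equivclp (gl_step Gs) p q" by (simp add: gl_class_def)
next
  assume "equivclp (gl_step Gs) p q"
  then show "gl_class Gs p = gl_class Gs q"
    unfolding gl_class_def by (blast intro: equivclp_trans equivclp_sym)
qed

text \<open>The retraction of the chain onto its \<open>i\<close>-th graph, collapsing everything to
  the left and everything to the right. It is compatible with \<open>gl_step\<close>, so it
  distinguishes classes without an explicit description of the generated equivalence.\<close>

definition retract :: "nat \<Rightarrow> nat \<times> 'v \<Rightarrow> 'v" where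
  "retract i p = (if fst p < i then tu (Gs ! i) else if fst p = i then snd p else tv (Gs ! i))"

lemma retract_equiv:
  assumes "equivclp (gl_step Gs) p q" shows "retract i p = retract i q"
  using assms
proof (induction rule: equivclp_induct)
  case (step y z)
  have "retract i y = retract i z" if "gl_step Gs y z" for y z
    using that by (auto simp: gl_step_def retract_def)
  then show ?case using step by metis
qed simp

lemma cls_inj: "i < n \<Longrightarrow> inj_on (cls i) (verts (g i))"
proof (rule inj_onI)
  fix x y assume "i < n" "x \<in> verts (g i)" "y \<in> verts (g i)" "cls i x = cls i y"
  then have "equivclp (gl_step Gs) (i, x) (i, y)" using cls_eq_iff base_iff by blast
  from retract_equiv[OF this, of i] show "x = y" by (simp add: retract_def)
qed

lemma v_eq_u: "Suc i < n \<Longrightarrow> v i = u (Suc i)"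
  using markedD by (subst cls_eq_iff) (auto simp: base_iff gl_step_def n_def)

text \<open>A class that meets graphs on both sides of a cut passes through all gluing points in
  between. Retracting to \<open>i\<close> puts \<open>x\<close> at the right mark, and retracting to
  a graph strictly in between shows that its two marks coincide.\<close>

lemma crossing:
  assumes "i \<le> m" "m < j" "j < n" and x: "x \<in> verts (g i)" and y: "y \<in> verts (g j)"
    and eq: "cls i x = cls j y"
  shows "cls i x = v m"
proof -
  have E: "equivclp (gl_step Gs) (i, x) (j, y)" using assms cls_eq_iff base_iff by auto
  have "x = tv (Gs ! i)" using retract_equiv[OF E, of i] assms by (simp add: retract_def)
  moreover have "v i = v m'" if "i \<le> m'" "m' \<le> m" for m'
    using that
  proof (induction m' rule: dec_induct)
    case (step m')
    have "tu (Gs ! Suc m') = tv (Gs ! Suc m')"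
      using retract_equiv[OF E, of "Suc m'"] step assms by (simp add: retract_def)
    then show ?case using step v_eq_u[of m'] assms by simp
  qed simp
  ultimately show ?thesis using assms by simp
qed

lemma embedding: "i < n \<Longrightarrow> graph_embedding (cls i) (g i)"
  using markedD cls_inj by unfold_locales auto

lemma piece_graph: "i < n \<Longrightarrow> is_graph (piece i)"
  unfolding piece_def by (rule graph_embedding.graph[OF embedding])

lemma piece_genus: "i < n \<Longrightarrow> genus (piece i) = genus (g i)"
  unfolding piece_def by (rule graph_embedding.genus[OF embedding])

lemma verts_piece: "i < n \<Longrightarrow> verts (piece i) = cls i ` verts (g i)"
  unfolding piece_def by (rule graph_embedding.verts_map[OF embedding])

lemma uv_in_piece: "i < n \<Longrightarrow> u i \<in> verts (piece i)" "i < n \<Longrightarrow> v i \<in> verts (piece i)"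
  using markedD by (auto simp: verts_piece)

lemma verts_segment: "verts (segment a b) = (\<Union>i\<in>{a..<b}. verts (piece i))"
  by (simp add: segment_def verts_def)

lemma segment_single: "segment a (Suc a) = piece a"
  by (simp add: segment_def verts_def mult_def)

lemma segment_split:
  assumes "a \<le> m" "m \<le> b" shows "segment a b = glue2 (segment a m) (segment m b)"
proof -
  have "{a..<b} = {a..<m} \<union> {m..<b}" using assms by auto
  moreover have "(\<Sum>i\<in>{a..<b}. mult (piece i) x y) = (\<Sum>i\<in>{a..<m}. mult (piece i) x y) + (\<Sum>i\<in>{m..<b}. mult (piece i) x y)" for x y
    using sum.atLeastLessThan_concat[OF assms] by metis
  ultimately show ?thesis by (simp add: glue2_def segment_def verts_def mult_def UN_Un)
qed

lemma segment_cut: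
  assumes "a \<le> m" "Suc m < b" "b \<le> n"
  shows "verts (segment a (Suc m)) \<inter> verts (segment (Suc m) b) = {v m}"
proof
  show "verts (segment a (Suc m)) \<inter> verts (segment (Suc m) b) \<subseteq> {v m}"
  proof
    fix c assume "c \<in> verts (segment a (Suc m)) \<inter> verts (segment (Suc m) b)"
    then obtain i j where ij: "i \<in> {a..<Suc m}" "j \<in> {Suc m..<b}" "c \<in> verts (piece i)" "c \<in> verts (piece j)"
      unfolding verts_segment by blast
    then have "i < n" "j < n" "i \<le> m" "m < j" using assms by auto
    then obtain x where "x \<in> verts (g i)" "c = cls i x" using ij(3) by (auto simp: verts_piece)
    moreover obtain y where "y \<in> verts (g j)" "c = cls j y"
      using ij(4) \<open>j < n\<close> by (auto simp: verts_piece)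
    ultimately show "c \<in> {v m}" using crossing[OF \<open>i \<le> m\<close> \<open>m < j\<close> \<open>j < n\<close>] by simp
  qed
  have "v m \<in> verts (piece m)" "v m \<in> verts (piece (Suc m))"
    using assms uv_in_piece[of m] uv_in_piece[of "Suc m"] v_eq_u[of m] by auto
  then show "{v m} \<subseteq> verts (segment a (Suc m)) \<inter> verts (segment (Suc m) b)"
    using assms by (auto simp: verts_segment)
qed

lemma segment_graph:
  assumes "a < b" "b \<le> n"
  shows "is_graph (segment a b) \<and> genus (segment a b) = (\<Sum>i\<in>{a..<b}. genus (g i))"
  using assms
proof (induction b)
  case (Suc b)
  show ?case
  proof (cases "a = b")
    case True
    then show ?thesis using Suc.prems by (simp add: segment_single piece_graph piece_genus)
  next
    case False
    then have "a < b" using Suc.prems by simp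
    then have IH: "is_graph (segment a b)" "genus (segment a b) = (\<Sum>i\<in>{a..<b}. genus (g i))"
      using Suc by auto
    have "vertex_gluing (segment a b) (piece b) (v (b - 1))"
      using IH piece_graph[of b] segment_cut[of a "b - 1" "Suc b"] Suc.prems \<open>a < b\<close>
      by unfold_locales (auto simp: segment_single)
    then show ?thesis
      using vertex_gluing.graph[of "segment a b" "piece b"] vertex_gluing.genus[of "segment a b" "piece b"]
        IH(2) piece_genus[of b] Suc.prems \<open>a < b\<close> segment_split[of a b "Suc b"]
      by (simp add: segment_single)
  qed
qed simp

lemma gluing:
  assumes "a \<le> m" "Suc m < b" "b \<le> n"
  shows "vertex_gluing (segment a (Suc m)) (segment (Suc m) b) (v m)"
  using segment_graph[of a "Suc m"] segment_graph[of "Suc m" b] segment_cut[OF assms] assms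
  by unfold_locales auto

text \<open>For a vertex \<open>A\<close> of the glued graph, which is a class, membership of
  \<open>(i, x)\<close> in \<open>A\<close> means that \<open>A\<close> is the image of
  \<open>x\<close>. So the sums in \<open>gl_graph\<close> are the multiplicities of the
  pieces.\<close>

lemma gl_graph_segment: "gl_graph Gs = segment 0 n"
proof -
  have V: "gl_class Gs ` gl_base Gs = verts (segment 0 n)"
    using verts_piece by (auto simp: verts_segment base_iff image_iff) (use base_iff in force)+
  have mem: "(i, x) \<in> A \<longleftrightarrow> cls i x = A"
    if A: "A \<in> gl_class Gs ` gl_base Gs" and i: "i < n" "x \<in> verts (g i)" for A i x
  proof -
    obtain p where p: "A = gl_class Gs p" "p \<in> gl_base Gs" using A by blast
    have "(i, x) \<in> gl_base Gs" using i by (simp add: base_iff)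
    then show ?thesis using cls_eq_iff[of p "(i, x)"] p by (auto simp: gl_class_def)
  qed
  have m: "mult (piece i) A B = (\<Sum>x\<in>verts (g i). \<Sum>y\<in>verts (g i). if (i, x) \<in> A \<and> (i, y) \<in> B then mult (g i) x y else 0)"
    if "A \<in> gl_class Gs ` gl_base Gs" "B \<in> gl_class Gs ` gl_base Gs" "i < n" for A B i
    unfolding piece_def map_graph_def mult_def[of "(_, _)"] snd_conv
    using mem that by (intro sum.cong refl) auto
  \<comment> \<open>\<open>gl_graph\<close> sets diagonal multiplicities to 0 explicitly; the
    segment has no loops because it is a graph.\<close>
  have outside: "mult (segment 0 n) A B = 0"
    if "\<not> (A \<in> verts (segment 0 n) \<and> B \<in> verts (segment 0 n) \<and> A \<noteq> B)" for A B
    using that segment_graph[of 0 n] mult_outside[of "segment 0 n"] graphD(4)[of "segment 0 n"] nonempty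
    by (cases "A = B") (auto simp: n_def)
  show ?thesis
  proof (rule prod_eqI)
    show "fst (gl_graph Gs) = fst (segment 0 n)" using V by (simp add: gl_graph_def verts_def)
    show "snd (gl_graph Gs) = snd (segment 0 n)"
    proof (intro ext)
      fix A B
      show "snd (gl_graph Gs) A B = snd (segment 0 n) A B"
      proof (cases "A \<in> verts (segment 0 n) \<and> B \<in> verts (segment 0 n) \<and> A \<noteq> B")
        case True
        then have "snd (gl_graph Gs) A B = (\<Sum>i<n. mult (piece i) A B)"
          using m V by (simp add: gl_graph_def n_def[symmetric])
        then show ?thesis by (simp add: segment_def atLeast0LessThan)
      next
        case False
        then show ?thesis using outside[OF False] V by (auto simp: gl_graph_def mult_def)
      qed
    qed
  qed
qed

lemma prefix_weight_bounded:
  assumes tr: "\<And>i. i \<le> m \<Longrightarrow> transmits (piece i) (u i) (v i) (k i)"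
    and k: "\<And>i. i \<le> m \<Longrightarrow> (\<Sum>j\<le>i. genus (g j)) < int (k i)" and m: "m < n"
  shows "weight_bounded (segment 0 (Suc m)) (v m)"
  using assms
proof (induction m)
  case 0
  then show ?case unfolding segment_single
    by (intro weight_bounded_transmits[OF piece_graph _ _ "0.prems"(1)]) (auto simp: uv_in_piece piece_genus)
next
  case (Suc m)
  interpret vertex_gluing "segment 0 (Suc m)" "segment (Suc m) (Suc (Suc m))" "v m"
    by (rule gluing) (use Suc.prems in auto)
  have "weight_bounded (glue2 (segment 0 (Suc m)) (segment (Suc m) (Suc (Suc m)))) (v (Suc m))"
  proof (rule weight_bounded_glue)
    show "v (Suc m) \<in> verts (segment (Suc m) (Suc (Suc m)))"
      using Suc.prems by (simp add: segment_single uv_in_piece)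
    show "weight_bounded (segment 0 (Suc m)) (v m)" using Suc by simp
    show "transmits (segment (Suc m) (Suc (Suc m))) (v m) (v (Suc m)) (k (Suc m))"
      using Suc.prems v_eq_u[of m] by (simp add: segment_single)
    show "genus (segment 0 (Suc m)) + genus (segment (Suc m) (Suc (Suc m))) < int (k (Suc m))"
      using Suc.prems(2)[of "Suc m"] Suc.prems(3) segment_graph[of 0 "Suc m"]
      by (simp add: segment_single piece_genus atLeast0LessThan lessThan_Suc_atMost)
  qed
  then show ?case using segment_split[of 0 "Suc m" "Suc (Suc m)"] by simp
qed

text \<open>Mirror image of the prefix case: the chain grows from its right end, each new graph is
  traversed from \<open>v i\<close> to \<open>u i\<close> by \<open>transmits_sym\<close>, and the
  sums of genera run to the end.\<close>

lemma suffix_weight_bounded: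
  assumes tr: "\<And>i. i < n \<Longrightarrow> transmits (piece i) (u i) (v i) (k i)"
    and k: "\<And>i. a \<le> i \<Longrightarrow> i < n \<Longrightarrow> (\<Sum>j\<in>{i..<n}. genus (g j)) < int (k i)" and a: "a < n"
  shows "weight_bounded (segment a n) (u a)"
proof -
  have "a \<le> n - 1" using a by simp
  then show ?thesis
  proof (induction rule: inc_induct)
    case base
    have n: "Suc (n - 1) = n" "n - 1 < n" using a by auto
    have "{n - 1..<n} = {n - 1}" using n by auto
    then have "genus (g (n - 1)) < int (k (n - 1))" using k[of "n - 1"] a by simp
    then have "weight_bounded (piece (n - 1)) (u (n - 1))"
      using n
      by (intro weight_bounded_transmits[OF piece_graph _ _ transmits_sym[OF tr]]) (auto simp: uv_in_piece piece_genus)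
    then show ?case using segment_single[of "n - 1"] n by simp
  next
    case (step m)
    then have m: "Suc m < n" by simp
    have w: "v m = u (Suc m)" using v_eq_u m by simp
    interpret S: vertex_gluing "segment m (Suc m)" "segment (Suc m) n" "v m"
      by (rule gluing) (use m in auto)
    interpret vertex_gluing "segment (Suc m) n" "segment m (Suc m)" "v m"
      using S.A S.B S.cut by unfold_locales auto
    have "weight_bounded (glue2 (segment (Suc m) n) (segment m (Suc m))) (u m)"
    proof (rule weight_bounded_glue)
      show "u m \<in> verts (segment m (Suc m))" using m by (simp add: segment_single uv_in_piece)
      show "weight_bounded (segment (Suc m) n) (v m)" using step w by simp
      show "transmits (segment m (Suc m)) (v m) (u m) (k m)"
        using tr m by (simp add: segment_single transmits_sym)
      show "genus (segment (Suc m) n) + genus (segment m (Suc m)) < int (k m)"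
        using k[of m] step m segment_graph[of "Suc m" n]
        by (simp add: segment_single piece_genus sum.atLeast_Suc_lessThan)
    qed
    then show ?case using segment_split[of m "Suc m" n] m by (simp add: glue2_commute)
  qed
qed

end

section \<open>The two claims for the iterated gluing\<close>

theorem theorem1p3:
  fixes Gs :: "('v graph \<times> 'v \<times> 'v) list" and k :: "nat \<Rightarrow> nat"
  assumes "Gs \<noteq> []"
    and "\<forall>i<length Gs. twice_marked (tg (Gs ! i)) (tu (Gs ! i)) (tv (Gs ! i))"
    and "\<forall>i<length Gs. torsion_order (tg (Gs ! i)) (tu (Gs ! i)) (tv (Gs ! i)) (k i)"
    and "\<forall>i<length Gs. general_transmission (tg (Gs ! i)) (tu (Gs ! i)) (tv (Gs ! i)) (k i)"
  shows "((\<forall>i<length Gs. (\<Sum>j\<le>i. genus (tg (Gs ! j))) < int (k i)) \<longrightarrow>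
            once_marked_bn_general (tg (glue Gs)) (tv (glue Gs)))
       \<and> ((\<forall>i<length Gs. min (\<Sum>j\<le>i. genus (tg (Gs ! j)))
                              (\<Sum>j\<in>{i..<length Gs}. genus (tg (Gs ! j))) < int (k i)) \<longrightarrow>
            bn_general (tg (glue Gs)))"
proof -
  interpret graph_chain Gs "length Gs"
    using assms by unfold_locales auto
  let ?n = "length Gs"
  let ?pre = "\<lambda>i. \<Sum>j\<le>i. genus (g j)" and ?suf = "\<lambda>i. \<Sum>j\<in>{i..<?n}. genus (g j)"
  have n: "0 < ?n" "?n - 1 < ?n" "Suc (?n - 1) = ?n" using assms(1) by auto
  have tr: "transmits (piece i) (u i) (v i) (k i)" if "i < ?n" for i
    unfolding piece_def using assms markedD that
    by (intro graph_embedding.transmits[OF embedding] general_transmission_transmits) auto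
  have G: "tg (glue Gs) = segment 0 ?n" "tv (glue Gs) = v (?n - 1)"
    by (simp_all add: glue_def tg_def tv_def gl_graph_segment)
  have graph: "is_graph (segment 0 ?n)" using segment_graph[of 0 ?n] n by simp
  have vG: "v (?n - 1) \<in> verts (segment 0 ?n)" and uG: "u 0 \<in> verts (segment 0 ?n)"
    using uv_in_piece(2)[OF n(2)] uv_in_piece(1)[OF n(1)] n
    unfolding verts_segment by (metis (no_types, lifting) UN_I atLeastLessThan_iff zero_le)+
  have gn: "0 \<le> genus (g i)" if "i < ?n" for i using genus_nonneg[OF markedD(1)[OF that]] .
  have prefix: "weight_bounded (segment 0 (Suc m)) (v m)" if "m < ?n" "\<forall>i\<le>m. ?pre i < int (k i)" for m
    using prefix_weight_bounded[of m k] tr that by simp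
  have all: "weight_bounded (segment 0 ?n) (v (?n - 1))" if "\<forall>i<?n. ?pre i < int (k i)"
    using prefix[of "?n - 1"] that n by simp
  have "bn_general (segment 0 ?n)" if min: "\<forall>i<?n. min (?pre i) (?suf i) < int (k i)"
  proof (cases "\<forall>i<?n. ?pre i < int (k i)")
    case True
    then show ?thesis using weight_bounded_bn_general[OF graph vG all] by simp
  next
    case False
    \<comment> \<open>The first graph whose prefix sum is too large; the chain is cut in front of
      it.\<close>
    define m where "m = (LEAST i. i < ?n \<and> \<not> ?pre i < int (k i))"
    have m: "m < ?n" "\<not> ?pre m < int (k m)"
      using LeastI_ex[of "\<lambda>i. i < ?n \<and> \<not> ?pre i < int (k i)"] False by (auto simp: m_def)
    have before: "?pre i < int (k i)" if "i < m" for i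
      using not_less_Least[OF that[unfolded m_def]] that m by auto
    \<comment> \<open>Suffix sums weakly decrease and prefix sums weakly increase with
      \<open>i\<close>. From \<open>?suf i < k m \<le> ?pre i\<close> the minimum at
      \<open>i\<close> is the suffix sum.\<close>
    have "?suf i < int (k i)" if i: "m \<le> i" "i < ?n" for i
    proof -
      have "?suf i \<le> ?suf m" by (rule sum_mono2) (use i gn in auto)
      also have "\<dots> < int (k m)" using min[rule_format, OF m(1)] m(2) by linarith
      also have "\<dots> \<le> ?pre m" using m(2) by simp
      also have "\<dots> \<le> ?pre i" by (rule sum_mono2) (use i gn in auto)
      finally show ?thesis using min[rule_format, OF i(2)] by linarith
    qed
    then have suffix: "weight_bounded (segment m ?n) (u m)"
      using suffix_weight_bounded[of k m] tr m(1) by simp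
    show ?thesis
    \<comment> \<open>If \<open>m = 0\<close>, the whole chain is a suffix with bounded weight at
      its first mark; otherwise the two halves meet in \<open>v l = u m\<close>.\<close>
    proof (cases m)
      case 0
      then show ?thesis using weight_bounded_bn_general[OF graph uG] suffix by simp
    next
      case (Suc l)
      interpret vertex_gluing "segment 0 (Suc l)" "segment (Suc l) ?n" "v l"
        by (rule gluing) (use Suc m in auto)
      have "bn_general (glue2 (segment 0 (Suc l)) (segment (Suc l) ?n))"
        using bn_general_glue prefix[of l] before suffix v_eq_u[of l] Suc m(1) by simp
      then show ?thesis using segment_split[of 0 "Suc l" ?n] Suc m(1) by simp
    qed
  qed
  then show ?thesis unfolding G using weight_bounded_once_marked[OF graph vG all] by blast
qed

end
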